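(* Let $m\in\mathbb{N}$ and $A\subseteq\mathbb{N}^m$. The following two statements are equivalent. (1) There exist functions $\alpha:\mathcal{P}_f(\mathbb{N}^{\mathbb{N}})\to\mathbb{N}$ and $H:\mathcal{P}_f(\mathbb{N}^{\mathbb{N}})\to\mathcal{P}_f(\mathbb{N})$ such that (a) if $F,G\in\mathcal{P}_f(\mathbb{N}^{\mathbb{N}})$ and $F\subsetneq G$, then $\max H(F)<\min H(G)$; and (b) whenever $(G_i)_{i\in\mathbb{N}}$ is a sequence in $\mathcal{P}_f(\mathbb{N}^{\mathbb{N}})$ with $G_1\subsetneq G_2\subsetneq\cdots\subsetneq G_n\subsetneq\cdots$, then for all $\beta_1<\cdots<\beta_m$ in $\mathcal{P}_f(\mathbb{N})$ and all choices of $f_i\in G_i$ ($i\in\mathbb{N}$), one has $$\left(\sum_{i\in\beta_1}\Bigl(\alpha(G_i)+\sum_{t\in H(G_i)}f_i(t)\Bigr),\ldots,\sum_{i\in\beta_m}\Bigl(\alpha(G_i)+\sum_{t\in H(G_i)}f_i(t)\Bigr)\right)\in A.$$ (2) There exists an idempotent $p$ in $(\mathcal{J},+)$ such that $A\in\bigotimes_{i=1}^m p$.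
   Context: $\mathbb{N}$ is the set of positive integers; $\mathcal{P}_f(X)$ is the set of nonempty finite subsets of $X$; $\mathbb{N}^{\mathbb{N}}$ is the set of all functions $\mathbb{N}\to\mathbb{N}$. For $\beta,\gamma\in\mathcal{P}_f(\mathbb{N})$, $\beta<\gamma$ means $\max\beta<\min\gamma$. $\beta\mathbb{N}$ is the set of ultrafilters on $\mathbb{N}$, with the operation: $A\in p+q$ iff $\{x\in\mathbb{N}:-x+A\in q\}\in p$, where $-x+A=\{y\in\mathbb{N}:x+y\in A\}$. An ultrafilter $p$ is idempotent if $p+p=p$. A set $A\subseteq\mathbb{N}$ is a $J$-set if for every $F\in\mathcal{P}_f(\mathbb{N}^{\mathbb{N}})$ there exist $a\in\mathbb{N}$ and $\beta\in\mathcal{P}_f(\mathbb{N})$ such that $a+\sum_{t\in\beta}f(t)\in A$ for all $f\in F$. $\mathcal{J}=\{p\in\beta\mathbb{N}:\text{every }A\in p\text{ is a }J\text{-set}\}$; it is a two-sided ideal of $(\beta\mathbb{N},+)$. Tensor products: for ultrafilters $p_1,\ldots,p_k$ on $\mathbb{N}$, $\bigotimes_{i=1}^k p_i$ is the ultrafilter on $\mathbb{N}^k$ defined recursively by $\bigotimes_{i=1}^1p_i=p_1$, and, for $A\subseteq\mathbb{N}^{k+1}$, $A\in\bigotimes_{i=1}^{k+1}p_i$ iff $\{(x_1,\ldots,x_k)\in\mathbb{N}^k:\{x_{k+1}\in\mathbb{N}:(x_1,\ldots,x_{k+1})\in A\}\in p_{k+1}\}\in\bigotimes_{i=1}^kp_i$.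 $\bigotimes_{i=1}^mp$ is the case $p_i=p$ for all $i$. *)

theory Defs
  imports Main "HOL-Library.FuncSet"
begin

text \<open>
  Since \<^typ>\<open>nat\<close> contains 0, the set of positive integers is an explicit
  carrier and all other objects are relativised to it.
\<close>
definition PosN :: "nat set" where
  "PosN = {n. 0 < n}"

definition Pf :: "'a set \<Rightarrow> 'a set set" where
  "Pf X = {F. F \<subseteq> X \<and> finite F \<and> F \<noteq> {}}"

text \<open>
  The functions from the positive integers to themselves. Extensionality (a fixed junk value at 0)
  matters: without it, functions differing only at 0 would count as distinct elements of finite
  sets of functions.
\<close>
definition PosFun :: "(nat \<Rightarrow> nat) set" where
  "PosFun = PosN \<rightarrow>\<^sub>E PosN"

text \<open>Used only for nonempty finite sets, where \<^const>\<open>Max\<close> and \<^const>\<open>Min\<close> are meaningful.\<close>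
definition set_before :: "nat set \<Rightarrow> nat set \<Rightarrow> bool" where
  "set_before B C \<longleftrightarrow> Max B < Min C"

definition ultrafilter_on :: "'a set \<Rightarrow> 'a set set \<Rightarrow> bool" where
  "ultrafilter_on X p \<longleftrightarrow>
     p \<subseteq> Pow X \<and> X \<in> p \<and> {} \<notin> p \<and>
     (\<forall>A\<in>p. \<forall>B\<in>p. A \<inter> B \<in> p) \<and>
     (\<forall>A\<in>p. \<forall>B. A \<subseteq> B \<and> B \<subseteq> X \<longrightarrow> B \<in> p) \<and>
     (\<forall>A. A \<subseteq> X \<longrightarrow> A \<in> p \<or> X - A \<in> p)"

definition betaN :: "nat set set set" where
  "betaN = {p. ultrafilter_on PosN p}"

definition uf_plus :: "nat set set \<Rightarrow> nat set set \<Rightarrow> nat set set" where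
  "uf_plus p q = {A. A \<subseteq> PosN \<and> {x \<in> PosN. {y \<in> PosN. x + y \<in> A} \<in> q} \<in> p}"

definition uf_idempotent :: "nat set set \<Rightarrow> bool" where
  "uf_idempotent p \<longleftrightarrow> uf_plus p p = p"

definition J_set :: "nat set \<Rightarrow> bool" where
  "J_set A \<longleftrightarrow> A \<subseteq> PosN \<and>
     (\<forall>F \<in> Pf PosFun. \<exists>a \<in> PosN. \<exists>B \<in> Pf PosN. \<forall>f\<in>F. a + (\<Sum>t\<in>B. f t) \<in> A)"

definition J_ultrafilters :: "nat set set set" where
  "J_ultrafilters = {p \<in> betaN. \<forall>A\<in>p. J_set A}"

definition tuples :: "nat \<Rightarrow> nat list set" where
  "tuples k = {xs. length xs = k \<and> set xs \<subseteq> PosN}"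

text \<open>
  The tensor product of p 1, ..., p k, an ultrafilter on \<^term>\<open>tuples k\<close>. The recursion starts at
  k = 1; the value at 0 is irrelevant (it is the unique ultrafilter on the set of empty tuples).
\<close>
fun tensor :: "(nat \<Rightarrow> nat set set) \<Rightarrow> nat \<Rightarrow> nat list set set" where
  "tensor p 0 = {{[]}}"
| "tensor p (Suc 0) = {A. A \<subseteq> tuples 1 \<and> {x \<in> PosN. [x] \<in> A} \<in> p 1}"
| "tensor p (Suc (Suc k)) =
     {A. A \<subseteq> tuples (Suc (Suc k)) \<and>
         {xs \<in> tuples (Suc k). {x \<in> PosN. xs @ [x] \<in> A} \<in> p (Suc (Suc k))} \<in> tensor p (Suc k)}"

end

theory Submission
  imports Defs
begin

text \<open>
  From functions to an ultrafilter: consider words of pairs \<open>(G, c)\<close> with strictly increasing \<open>G\<close>,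
  where \<open>c\<close> is an element of \<open>G\<close> or a variable. Among the ultrafilters concentrated on constant
  words above every finite set of functions, choose a minimal idempotent \<open>u\<close>, and below it an
  idempotent \<open>q\<close> concentrated on words with a variable. Substituting any function for the variable
  maps \<open>q\<close> to an idempotent below \<open>u\<close>, hence to \<open>u\<close> by minimality. So every member of \<open>u\<close> contains
  all the instances, for any finite set of functions, of one variable word. Evaluating words with
  \<open>\<alpha>\<close> and \<open>H\<close> is a homomorphism, and the image of \<open>u\<close> is the required \<open>p\<close>. No partition
  regularity of J-sets is needed.

  From an ultrafilter to functions: \<open>\<alpha>(F)\<close> and \<open>H(F)\<close> are chosen by recursion along strict
  inclusion, keeping all the finitely many outputs so far inside the star set of the appropriate
  section of \<open>A\<close>.
\<close>

section \<open>Ultrafilters and minimal idempotents\<close>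

abbreviation ultra :: "'a set set \<Rightarrow> bool" where
  "ultra \<equiv> ultrafilter_on UNIV"

lemma ultrafilter_on_upward:
  "ultrafilter_on X p \<Longrightarrow> A \<in> p \<Longrightarrow> A \<subseteq> B \<Longrightarrow> B \<subseteq> X \<Longrightarrow> B \<in> p"
  unfolding ultrafilter_on_def by blast

lemma ultrafilter_on_Int_iff:
  assumes "ultrafilter_on X p" "A \<subseteq> X" "B \<subseteq> X"
  shows "A \<inter> B \<in> p \<longleftrightarrow> A \<in> p \<and> B \<in> p"
  using assms unfolding ultrafilter_on_def by (meson Int_lower1 Int_lower2)

lemma ultrafilter_on_Diff_iff:
  assumes "ultrafilter_on X p" "A \<subseteq> X"
  shows "X - A \<in> p \<longleftrightarrow> A \<notin> p"
proof
  assume "X - A \<in> p"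
  then show "A \<notin> p"
    using assms unfolding ultrafilter_on_def by (metis Diff_disjoint)
next
  assume "A \<notin> p"
  then show "X - A \<in> p"
    using assms unfolding ultrafilter_on_def by blast
qed

lemma ultrafilter_on_nonempty: "ultrafilter_on X p \<Longrightarrow> A \<in> p \<Longrightarrow> A \<noteq> {}"
  unfolding ultrafilter_on_def by blast

text \<open>Meeting with X covers the empty family, whose intersection is the whole type.\<close>

lemma ultrafilter_on_Inter:
  assumes "ultrafilter_on X p" "finite \<G>" "\<G> \<subseteq> p"
  shows "X \<inter> \<Inter>\<G> \<in> p"
  using assms(2,3)
proof (induction \<G>)
  case empty
  then show ?case using assms(1) by (simp add: ultrafilter_on_def)
next
  case (insert A \<G>)
  then have "A \<inter> (X \<inter> \<Inter>\<G>) \<in> p"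
    using assms(1) by (simp add: ultrafilter_on_def)
  then show ?case by (simp add: Int_left_commute)
qed

lemma ultrafilter_on_eqI:
  assumes "ultrafilter_on X p" "ultrafilter_on X q" "p \<subseteq> q"
  shows "p = q"
proof
  show "q \<subseteq> p"
  proof
    fix A assume A: "A \<in> q"
    then have "A \<subseteq> X" using assms(2) by (auto simp: ultrafilter_on_def)
    then show "A \<in> p" using assms A ultrafilter_on_Diff_iff by blast
  qed
qed fact

lemma ultra_mono: "ultra p \<Longrightarrow> A \<in> p \<Longrightarrow> A \<subseteq> B \<Longrightarrow> B \<in> p"
  using ultrafilter_on_upward by blast

lemma ultra_Int_iff: "ultra p \<Longrightarrow> A \<inter> B \<in> p \<longleftrightarrow> A \<in> p \<and> B \<in> p"
  by (simp add: ultrafilter_on_Int_iff)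

lemma ultra_Compl_iff: "ultra p \<Longrightarrow> - A \<in> p \<longleftrightarrow> A \<notin> p"
  using ultrafilter_on_Diff_iff[of UNIV p A] by (simp add: Compl_eq_Diff_UNIV)

lemma ultra_Collect_conj:
  "ultra p \<Longrightarrow> {x. P x \<and> Q x} \<in> p \<longleftrightarrow> {x. P x} \<in> p \<and> {x. Q x} \<in> p"
  by (simp add: Collect_conj_eq ultra_Int_iff)

lemma ultra_Collect_not: "ultra p \<Longrightarrow> {x. \<not> P x} \<in> p \<longleftrightarrow> {x. P x} \<notin> p"
  by (simp add: Collect_neg_eq ultra_Compl_iff)

lemma ultra_cong: "ultra p \<Longrightarrow> X \<in> p \<Longrightarrow> A \<inter> X = B \<inter> X \<Longrightarrow> A \<in> p \<longleftrightarrow> B \<in> p"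
  by (metis ultra_Int_iff)

lemma ultraI:
  assumes "UNIV \<in> p" "\<And>A B. A \<in> p \<Longrightarrow> B \<in> p \<Longrightarrow> A \<inter> B \<in> p"
    and "\<And>A B. A \<in> p \<Longrightarrow> A \<subseteq> B \<Longrightarrow> B \<in> p" and "\<And>A. - A \<in> p \<longleftrightarrow> A \<notin> p"
  shows "ultra p"
proof -
  have "{} \<notin> p" using assms(1) assms(4)[of UNIV] by simp
  then show ?thesis
    unfolding ultrafilter_on_def using assms by (auto simp flip: Compl_eq_Diff_UNIV)
qed

section \<open>The finite intersection property and the ultrafilter lemma\<close>

definition has_fip :: "'a set set \<Rightarrow> bool" where
  "has_fip \<F> \<longleftrightarrow> (\<forall>\<G>. finite \<G> \<longrightarrow> \<G> \<subseteq> \<F> \<longrightarrow> \<Inter>\<G> \<noteq> {})"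

text \<open>If both extensions failed, dropping A from one bad finite family and -A from the other
  would leave finitely many members of \<F>. A common point of these would lie in A or in -A, hence
  in one of the two empty intersections.\<close>

lemma has_fip_insert:
  assumes "has_fip \<F>"
  shows "has_fip (insert A \<F>) \<or> has_fip (insert (- A) \<F>)"
proof (rule ccontr)
  assume "\<not> ?thesis"
  then obtain \<G> \<H> where
      G: "finite \<G>" "\<G> \<subseteq> insert A \<F>" "\<Inter>\<G> = {}" and
      H: "finite \<H>" "\<H> \<subseteq> insert (- A) \<F>" "\<Inter>\<H> = {}"
    unfolding has_fip_def by blast
  have "\<Inter>((\<G> - {A}) \<union> (\<H> - {- A})) \<subseteq> \<Inter>\<G> \<union> \<Inter>\<H>"
    by auto
  moreover have "finite ((\<G> - {A}) \<union> (\<H> - {- A}))" "(\<G> - {A}) \<union> (\<H> - {- A}) \<subseteq> \<F>"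
    using G H by auto
  ultimately show False
    using assms G(3) H(3) unfolding has_fip_def by (metis subset_empty sup_bot.right_neutral)
qed

text \<open>Zorn's lemma gives a maximal family with the finite intersection property. By
  \<open>has_fip_insert\<close> it contains A or -A for every A, and a family with these two
  properties is an ultrafilter.\<close>

lemma ultra_extend:
  assumes "has_fip \<F>"
  shows "\<exists>p. ultra p \<and> \<F> \<subseteq> p"
proof -
  let ?P = "{\<G>. has_fip \<G> \<and> \<F> \<subseteq> \<G>}"
  have "\<exists>M\<in>?P. \<forall>X\<in>?P. M \<subseteq> X \<longrightarrow> X = M"
  proof (rule subset_Zorn_nonempty)
    show "?P \<noteq> {}" using assms by blast
    fix C assume C: "C \<noteq> {}" "subset.chain ?P C"
    have "has_fip (\<Union>C)"
      unfolding has_fip_def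
    proof (intro allI impI)
      fix \<G> assume "finite \<G>" "\<G> \<subseteq> \<Union>C"
      then obtain B where "B \<in> C" "\<G> \<subseteq> B"
        using C finite_subset_Union_chain by blast
      then show "\<Inter>\<G> \<noteq> {}"
        using C(2) \<open>finite \<G>\<close> unfolding subset.chain_def has_fip_def by blast
    qed
    then show "\<Union>C \<in> ?P"
      using C unfolding subset.chain_def by blast
  qed
  then obtain p where p: "has_fip p" "\<F> \<subseteq> p" and
    max: "\<And>X. has_fip X \<Longrightarrow> p \<subseteq> X \<Longrightarrow> X = p" by auto
  have dec: "A \<in> p \<or> - A \<in> p" for A
    using has_fip_insert[OF p(1), of A] max by blast
  have memI: "A \<in> p" if "\<G> \<subseteq> p" "finite \<G>" "\<Inter>\<G> \<subseteq> A" for A \<G>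
  proof (rule ccontr)
    assume "A \<notin> p"
    then have "insert (- A) \<G> \<subseteq> p" "finite (insert (- A) \<G>)" "\<Inter>(insert (- A) \<G>) = {}"
      using dec that by auto
    then show False using p(1) unfolding has_fip_def by blast
  qed
  have "ultra p"
  proof (rule ultraI)
    show "UNIV \<in> p" using memI[of "{}"] by simp
    show "A \<inter> B \<in> p" if "A \<in> p" "B \<in> p" for A B
      using memI[of "{A, B}"] that by simp
    show "B \<in> p" if "A \<in> p" "A \<subseteq> B" for A B
      using memI[of "{A}"] that by simp
    show "- A \<in> p \<longleftrightarrow> A \<notin> p" for A
    proof -
      have "\<not> (A \<in> p \<and> - A \<in> p)"
        using p(1)[unfolded has_fip_def, rule_format, of "{A, - A}"] by auto
      then show ?thesis using dec by blast
    qed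
  qed
  then show ?thesis using p(2) by blast
qed

section \<open>Closed sets of ultrafilters and compactness\<close>

text \<open>These are the closed sets of the Stone-Cech compactification of the discrete type,
  described without a topology: a closed set is an intersection of basic clopen sets, one for each
  member of \<F>.\<close>

definition uf_closed :: "'a set set set \<Rightarrow> bool" where
  "uf_closed C \<longleftrightarrow> (\<exists>\<F>. C = {p. ultra p \<and> \<F> \<subseteq> p})"

lemma uf_closedI: "C = {p. ultra p \<and> \<F> \<subseteq> p} \<Longrightarrow> uf_closed C"
  unfolding uf_closed_def by blast

lemma uf_closed_ultra: "uf_closed C \<Longrightarrow> p \<in> C \<Longrightarrow> ultra p"
  unfolding uf_closed_def by blast

text \<open>\<open>\<Inter>C\<close> is the largest family defining C, so it serves as a canonical
  choice. For empty C it consists of all sets, and no ultrafilter contains it.\<close>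

lemma uf_closed_mem_iff: "uf_closed C \<Longrightarrow> p \<in> C \<longleftrightarrow> ultra p \<and> \<Inter>C \<subseteq> p"
  unfolding uf_closed_def by auto

lemma uf_closed_Int:
  assumes "uf_closed C" "uf_closed D"
  shows "uf_closed (C \<inter> D)"
proof -
  obtain \<F> \<G> where "C = {p. ultra p \<and> \<F> \<subseteq> p}" "D = {p. ultra p \<and> \<G> \<subseteq> p}"
    using assms unfolding uf_closed_def by blast
  then show ?thesis by (intro uf_closedI[of _ "\<F> \<union> \<G>"]) auto
qed

text \<open>Compactness for chains. The families \<open>\<Inter>C\<close> grow as C shrinks, so
  finitely many sets from their union lie in a single one; any ultrafilter in that C contains these
  sets, and their intersection is nonempty.\<close>

lemma uf_closed_Inter_chain:
  assumes "\<C> \<noteq> {}" "subset.chain UNIV \<C>" "\<And>C. C \<in> \<C> \<Longrightarrow> uf_closed C \<and> C \<noteq> {}"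
  shows "uf_closed (\<Inter>\<C>)" "\<Inter>\<C> \<noteq> {}"
proof -
  let ?F = "\<Union>(Inter ` \<C>)"
  have eq: "\<Inter>\<C> = {p. ultra p \<and> ?F \<subseteq> p}"
  proof (rule set_eqI)
    fix p
    have mem: "p \<in> C \<longleftrightarrow> ultra p \<and> \<Inter>C \<subseteq> p" if "C \<in> \<C>" for C
      using uf_closed_mem_iff assms(3)[OF that] by blast
    have "p \<in> \<Inter>\<C> \<longleftrightarrow> (\<forall>C\<in>\<C>. ultra p \<and> \<Inter>C \<subseteq> p)"
      by (simp only: Inter_iff mem cong: ball_cong)
    also have "\<dots> \<longleftrightarrow> p \<in> {p. ultra p \<and> ?F \<subseteq> p}"
      using assms(1) by (simp only: UN_subset_iff mem_Collect_eq) blast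
    finally show "p \<in> \<Inter>\<C> \<longleftrightarrow> p \<in> {p. ultra p \<and> ?F \<subseteq> p}" .
  qed
  then show "uf_closed (\<Inter>\<C>)" by (rule uf_closedI)
  have ch: "subset.chain UNIV (Inter ` \<C>)"
    unfolding subset_chain_def
  proof (intro conjI ballI subset_UNIV)
    fix X Y assume "X \<in> Inter ` \<C>" "Y \<in> Inter ` \<C>"
    then obtain C D where "C \<in> \<C>" "D \<in> \<C>" "X = \<Inter>C" "Y = \<Inter>D" by blast
    then show "X \<subseteq> Y \<or> Y \<subseteq> X"
      using assms(2) Inter_anti_mono unfolding subset_chain_def by metis
  qed
  have "has_fip ?F"
    unfolding has_fip_def
  proof (intro allI impI)
    fix \<G> assume G: "finite \<G>" "\<G> \<subseteq> ?F"
    obtain B where "B \<in> Inter ` \<C>" "\<G> \<subseteq> B"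
      using finite_subset_Union_chain[OF G _ ch] assms(1) by blast
    then obtain C where C: "C \<in> \<C>" "\<G> \<subseteq> \<Inter>C" by blast
    then obtain p where p: "p \<in> C" "ultra p"
      using assms(3) uf_closed_ultra by blast
    have "\<G> \<subseteq> p" using C(2) Inter_lower[OF p(1)] by (rule subset_trans)
    then have "UNIV \<inter> \<Inter>\<G> \<in> p" using ultrafilter_on_Inter[OF p(2) G(1)] by blast
    then show "\<Inter>\<G> \<noteq> {}" using ultrafilter_on_nonempty[OF p(2)] by simp
  qed
  then obtain p where "ultra p \<and> ?F \<subseteq> p" using ultra_extend by blast
  then have "p \<in> \<Inter>\<C>" unfolding eq by (rule CollectI)
  then show "\<Inter>\<C> \<noteq> {}" by (metis empty_iff)
qed

text \<open>Applied below with P saying that a set is a subsemigroup or a left ideal of T; both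
  survive intersections of chains.\<close>

lemma minimal_uf_closed:
  assumes "uf_closed C" "C \<noteq> {}" "P C"
    and "\<And>\<C>. \<C> \<noteq> {} \<Longrightarrow> subset.chain UNIV \<C> \<Longrightarrow> (\<And>C. C \<in> \<C> \<Longrightarrow> P C) \<Longrightarrow> P (\<Inter>\<C>)"
  obtains M where "uf_closed M" "M \<noteq> {}" "P M"
    "\<And>D. uf_closed D \<Longrightarrow> D \<noteq> {} \<Longrightarrow> P D \<Longrightarrow> D \<subseteq> M \<Longrightarrow> D = M"
proof -
  \<comment> \<open>Complements turn the minimal element sought into the maximal one that Zorn's
    lemma provides.\<close>
  let ?S = "{D. uf_closed (- D) \<and> - D \<noteq> {} \<and> P (- D)}"
  have "\<exists>M\<in>?S. \<forall>X\<in>?S. M \<subseteq> X \<longrightarrow> X = M"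
  proof (rule subset_Zorn_nonempty)
    show "?S \<noteq> {}" using assms(1-3) by (auto intro!: exI[of _ "- C"])
    fix \<D> assume D: "\<D> \<noteq> {}" "subset.chain ?S \<D>"
    have ne: "uminus ` \<D> \<noteq> {}" using D by simp
    have ch: "subset.chain UNIV (uminus ` \<D>)"
      using D(2) unfolding subset_chain_def by (simp add: disj_commute)
    have mem: "uf_closed C \<and> C \<noteq> {}" "P C" if "C \<in> uminus ` \<D>" for C
      using that D(2) unfolding subset_chain_def by auto
    have "- \<Union>\<D> = \<Inter>(uminus ` \<D>)" by auto
    then show "\<Union>\<D> \<in> ?S"
      using uf_closed_Inter_chain[OF ne ch mem(1)] assms(4)[OF ne ch mem(2)] by simp
  qed
  then obtain M where M: "M \<in> ?S" and max: "\<And>X. X \<in> ?S \<Longrightarrow> M \<subseteq> X \<Longrightarrow> X = M"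
    by auto
  show thesis
  proof (rule that[of "- M"])
    fix D assume "uf_closed D" "D \<noteq> {}" "P D" "D \<subseteq> - M"
    then show "D = - M" using max[of "- D"] by auto
  qed (use M in auto)
qed

section \<open>Products of ultrafilters\<close>

definition uf_mult :: "('a \<Rightarrow> 'a \<Rightarrow> 'a) \<Rightarrow> 'a set set \<Rightarrow> 'a set set \<Rightarrow> 'a set set" where
  "uf_mult f p q = {A. {x. {y. f x y \<in> A} \<in> q} \<in> p}"

lemma mem_uf_mult: "A \<in> uf_mult f p q \<longleftrightarrow> {x. {y. f x y \<in> A} \<in> q} \<in> p"
  by (simp add: uf_mult_def)

lemma ultra_uf_mult:
  assumes "ultra p" "ultra q"
  shows "ultra (uf_mult f p q)"
proof (rule ultraI)
  have [simp]: "UNIV \<in> p" "UNIV \<in> q" using assms by (auto simp: ultrafilter_on_def)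
  show "UNIV \<in> uf_mult f p q" by (simp add: mem_uf_mult)
  show "A \<inter> B \<in> uf_mult f p q" if "A \<in> uf_mult f p q" "B \<in> uf_mult f p q" for A B
    using that assms by (simp add: mem_uf_mult ultra_Collect_conj)
  show "B \<in> uf_mult f p q" if "A \<in> uf_mult f p q" "A \<subseteq> B" for A B
    using that unfolding mem_uf_mult
    by (elim ultra_mono[OF assms(1)]) (auto elim!: ultra_mono[OF assms(2)])
  show "- A \<in> uf_mult f p q \<longleftrightarrow> A \<notin> uf_mult f p q" for A
    using assms by (simp add: mem_uf_mult ultra_Collect_not)
qed

text \<open>Right multiplication by q is continuous: \<open>\<phi>\<close> commutes with
  intersections and complements, and A is in the product of x and q iff \<open>\<phi> A\<close> is
  in x. The image of C consists of the ultrafilters r that contain every A forced by all x in C; a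
  point of C over such an r exists by the finite intersection property.\<close>

lemma uf_closed_right_mult:
  assumes C: "uf_closed C" and q: "ultra q"
  shows "uf_closed ((\<lambda>x. uf_mult f x q) ` C)"
proof -
  define \<phi> where "\<phi> A = {x. {y. f x y \<in> A} \<in> q}" for A
  have \<phi>: "A \<in> uf_mult f x q \<longleftrightarrow> \<phi> A \<in> x" for A x by (simp add: mem_uf_mult \<phi>_def)
  have \<phi>_Int: "\<phi> A \<inter> \<phi> B = \<phi> (A \<inter> B)" for A B
    using ultra_Collect_conj[OF q] by (auto simp: \<phi>_def)
  have \<phi>_Compl: "\<phi> (- A) = - \<phi> A" for A
    using ultra_Collect_not[OF q] by (auto simp: \<phi>_def)
  have "(\<lambda>x. uf_mult f x q) ` C = {r. ultra r \<and> {A. \<forall>x\<in>C. \<phi> A \<in> x} \<subseteq> r}"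
  proof (intro equalityI subsetI)
    fix r assume "r \<in> (\<lambda>x. uf_mult f x q) ` C"
    then show "r \<in> {r. ultra r \<and> {A. \<forall>x\<in>C. \<phi> A \<in> x} \<subseteq> r}"
      using \<phi> ultra_uf_mult[OF uf_closed_ultra[OF C] q] by auto
  next
    fix r assume "r \<in> {r. ultra r \<and> {A. \<forall>x\<in>C. \<phi> A \<in> x} \<subseteq> r}"
    then have r: "ultra r" and sub: "\<And>A. \<forall>x\<in>C. \<phi> A \<in> x \<Longrightarrow> A \<in> r" by auto
    have "has_fip (\<Inter>C \<union> \<phi> ` r)"
      unfolding has_fip_def
    proof (intro allI impI)
      fix \<G> assume G: "finite \<G>" "\<G> \<subseteq> \<Inter>C \<union> \<phi> ` r"
      then obtain \<H> where H: "finite \<H>" "\<H> \<subseteq> r" "\<G> - \<Inter>C = \<phi> ` \<H>"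
        using finite_subset_image[of "\<G> - \<Inter>C" \<phi> r] by blast
      have B: "\<Inter>\<H> \<in> r" using ultrafilter_on_Inter[OF r H(1,2)] by simp
      \<comment> \<open>Otherwise \<open>\<phi> (- \<Inter>\<H>)\<close> would lie in every x of C,
        which would put \<open>- \<Inter>\<H>\<close> into r.\<close>
      obtain x where x: "x \<in> C" "\<phi> (\<Inter>\<H>) \<in> x"
      proof -
        have "\<not> (\<forall>x\<in>C. \<phi> (- \<Inter>\<H>) \<in> x)"
          using sub B ultra_Compl_iff[OF r] by blast
        then show thesis
          using that \<phi>_Compl ultra_Compl_iff uf_closed_ultra[OF C] by metis
      qed
      have ux: "ultra x" using C x uf_closed_ultra by blast
      have "\<G> \<subseteq> x"
      proof
        fix A assume A: "A \<in> \<G>"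
        show "A \<in> x"
        proof (cases "A \<in> \<Inter>C")
          case True
          then show ?thesis using x(1) by (rule InterD)
        next
          case False
          then obtain B where B: "B \<in> \<H>" "A = \<phi> B" using A H(3) by blast
          have "\<phi> (\<Inter>\<H>) = \<phi> (\<Inter>\<H>) \<inter> \<phi> B"
            unfolding \<phi>_Int using Inter_lower[OF B(1)] by (simp add: Int_absorb2)
          then have "\<phi> (\<Inter>\<H>) \<subseteq> A" using B(2) by (metis Int_lower2)
          then show ?thesis by (rule ultra_mono[OF ux x(2)])
        qed
      qed
      then show "\<Inter>\<G> \<noteq> {}"
        using ultrafilter_on_Inter[OF ux G(1)] ultrafilter_on_nonempty[OF ux] by simp
    qed
    then obtain x where x: "ultra x" "\<Inter>C \<union> \<phi> ` r \<subseteq> x" using ultra_extend by blast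
    then have "x \<in> C" using uf_closed_mem_iff[OF C] by simp
    moreover have "r = uf_mult f x q"
      using ultrafilter_on_eqI[OF r ultra_uf_mult[OF x(1) q]] x(2) \<phi> by blast
    ultimately show "r \<in> (\<lambda>x. uf_mult f x q) ` C" by blast
  qed
  then show ?thesis by (rule uf_closedI)
qed

text \<open>One inclusion between ultrafilters is already equality, so the fibre is described by the
  sets that must belong to x.\<close>

lemma uf_closed_right_fibre:
  fixes q :: "'a set set"
  assumes "ultra q" "ultra r"
  shows "uf_closed {x. ultra x \<and> uf_mult f x q = r}"
proof (rule uf_closedI)
  show "{x. ultra x \<and> uf_mult f x q = r} =
    {x. ultra x \<and> {{x. {y. f x y \<in> A} \<in> q} |A. A \<in> r} \<subseteq> x}"
  proof (intro Collect_cong conj_cong refl)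
    fix x :: "'a set set" assume x: "ultra x"
    have "uf_mult f x q = r \<longleftrightarrow> r \<subseteq> uf_mult f x q"
      using ultrafilter_on_eqI[OF assms(2) ultra_uf_mult[OF x assms(1)]] by blast
    then show "uf_mult f x q = r \<longleftrightarrow> {{x. {y. f x y \<in> A} \<in> q} |A. A \<in> r} \<subseteq> x"
      by (auto simp: mem_uf_mult subset_eq)
  qed
qed

section \<open>Idempotents in closed subsemigroups\<close>

definition closed_subsemigroup :: "('a \<Rightarrow> 'a \<Rightarrow> 'a) \<Rightarrow> 'a set set set \<Rightarrow> bool" where
  "closed_subsemigroup f T \<longleftrightarrow> uf_closed T \<and> T \<noteq> {} \<and> (\<forall>x\<in>T. \<forall>y\<in>T. uf_mult f x y \<in> T)"

context semigroup
begin

abbreviation umult (infixl "\<odot>" 70) where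
  "umult \<equiv> uf_mult (\<^bold>*)"

lemma umult_assoc: "p \<odot> q \<odot> r = p \<odot> (q \<odot> r)"
  by (auto simp: uf_mult_def assoc)

text \<open>The Ellis-Numakura lemma. In a minimal closed subsemigroup M choose e. Minimality gives
  M e = M, so some z in M satisfies z e = e; the set of all such z is again a closed subsemigroup,
  hence equals M and contains e.\<close>

lemma idempotent_exists:
  assumes "closed_subsemigroup (\<^bold>*) T"
  obtains e where "e \<in> T" "e \<odot> e = e"
proof -
  obtain M where M: "uf_closed M" "M \<noteq> {}" "M \<subseteq> T" "\<forall>x\<in>M. \<forall>y\<in>M. x \<odot> y \<in> M" and
    min: "\<And>D. uf_closed D \<Longrightarrow> D \<noteq> {} \<Longrightarrow> D \<subseteq> T \<and> (\<forall>x\<in>D. \<forall>y\<in>D. x \<odot> y \<in> D) \<Longrightarrow> D \<subseteq> M \<Longrightarrow> D = M"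
  proof (rule minimal_uf_closed[of T "\<lambda>M. M \<subseteq> T \<and> (\<forall>x\<in>M. \<forall>y\<in>M. x \<odot> y \<in> M)"])
    fix \<C> :: "'a set set set set"
    assume "\<C> \<noteq> {}" "\<And>C. C \<in> \<C> \<Longrightarrow> C \<subseteq> T \<and> (\<forall>x\<in>C. \<forall>y\<in>C. x \<odot> y \<in> C)"
    then show "\<Inter>\<C> \<subseteq> T \<and> (\<forall>x\<in>\<Inter>\<C>. \<forall>y\<in>\<Inter>\<C>. x \<odot> y \<in> \<Inter>\<C>)" by blast
  qed (use assms in \<open>auto simp: closed_subsemigroup_def\<close>)
  obtain e where e: "e \<in> M" using M by blast
  have ue: "ultra e" using e M uf_closed_ultra by blast
  have "(\<lambda>x. x \<odot> e) ` M = M"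
  proof (rule min)
    show "uf_closed ((\<lambda>x. x \<odot> e) ` M)" using uf_closed_right_mult M ue by blast
  qed (use M e in \<open>auto simp flip: umult_assoc\<close>)
  then obtain z where z: "z \<in> M" "z \<odot> e = e" using e by (metis imageE)
  let ?N = "M \<inter> {x. ultra x \<and> x \<odot> e = e}"
  have "?N = M"
  proof (rule min)
    show "uf_closed ?N" using uf_closed_Int M uf_closed_right_fibre ue by blast
    show "?N \<noteq> {}" using z uf_closed_ultra[OF M(1)] by auto
    show "?N \<subseteq> T \<and> (\<forall>x\<in>?N. \<forall>y\<in>?N. x \<odot> y \<in> ?N)"
    proof (intro conjI ballI)
      show "?N \<subseteq> T" using M(3) by blast
      fix x y assume "x \<in> ?N" "y \<in> ?N"
      then show "x \<odot> y \<in> ?N" using M(4) by (simp add: umult_assoc ultra_uf_mult)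
    qed
  qed (rule Int_lower1)
  then have "e \<odot> e = e" using e by auto
  then show thesis using e M(3) by (intro that[of e]) auto
qed

text \<open>e is an idempotent of a minimal closed left ideal L of T. If q is an idempotent below e,
  then q = q e lies in L, so L q = L by minimality and e = x q for some x. Therefore e = e q =
  q.\<close>

lemma minimal_idempotent_exists:
  assumes T: "closed_subsemigroup (\<^bold>*) T"
  obtains e where "e \<in> T" "e \<odot> e = e"
    "\<And>q. q \<in> T \<Longrightarrow> q \<odot> q = q \<Longrightarrow> q \<odot> e = q \<Longrightarrow> e \<odot> q = q \<Longrightarrow> q = e"
proof -
  obtain L where L: "uf_closed L" "L \<noteq> {}" "L \<subseteq> T" "\<forall>x\<in>T. \<forall>y\<in>L. x \<odot> y \<in> L" and
    min: "\<And>D. uf_closed D \<Longrightarrow> D \<noteq> {} \<Longrightarrow> D \<subseteq> T \<and> (\<forall>x\<in>T. \<forall>y\<in>D. x \<odot> y \<in> D) \<Longrightarrow> D \<subseteq> L \<Longrightarrow> D = L"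
  proof (rule minimal_uf_closed[of T "\<lambda>L. L \<subseteq> T \<and> (\<forall>x\<in>T. \<forall>y\<in>L. x \<odot> y \<in> L)"])
    fix \<C> :: "'a set set set set"
    assume "\<C> \<noteq> {}" "\<And>C. C \<in> \<C> \<Longrightarrow> C \<subseteq> T \<and> (\<forall>x\<in>T. \<forall>y\<in>C. x \<odot> y \<in> C)"
    then show "\<Inter>\<C> \<subseteq> T \<and> (\<forall>x\<in>T. \<forall>y\<in>\<Inter>\<C>. x \<odot> y \<in> \<Inter>\<C>)" by blast
  qed (use T in \<open>auto simp: closed_subsemigroup_def\<close>)
  have "closed_subsemigroup (\<^bold>*) L" using L unfolding closed_subsemigroup_def by blast
  then obtain e where e: "e \<in> L" "e \<odot> e = e" using idempotent_exists by blast
  show thesis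
  proof (rule that)
    show "e \<in> T" "e \<odot> e = e" using e L by auto
    fix q assume q: "q \<in> T" "q \<odot> q = q" "q \<odot> e = q" "e \<odot> q = q"
    have qL: "q \<in> L" using q L e by metis
    have "(\<lambda>x. x \<odot> q) ` L = L"
    proof (rule min)
      show "uf_closed ((\<lambda>x. x \<odot> q) ` L)"
        using uf_closed_right_mult L uf_closed_ultra qL by blast
      show "(\<lambda>x. x \<odot> q) ` L \<subseteq> T \<and> (\<forall>x\<in>T. \<forall>y\<in>(\<lambda>x. x \<odot> q) ` L. x \<odot> y \<in> (\<lambda>x. x \<odot> q) ` L)"
        using L qL by (auto simp flip: umult_assoc)
    qed (use L qL in auto)
    then obtain x where "e = x \<odot> q" using e by (metis imageE)
    then have "e \<odot> q = e" using q by (simp add: umult_assoc)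
    then show "q = e" using q by simp
  qed
qed

text \<open>An idempotent r of I e satisfies r e = r, which makes e r an idempotent below e; the
  ideal conditions keep it in I.\<close>

lemma idempotent_below:
  assumes I: "closed_subsemigroup (\<^bold>*) I" and e: "ultra e" "e \<odot> e = e"
    and ideal: "\<And>x. x \<in> I \<Longrightarrow> x \<odot> e \<in> I" "\<And>x. x \<in> I \<Longrightarrow> e \<odot> x \<in> I"
  obtains q where "q \<in> I" "q \<odot> q = q" "q \<odot> e = q" "e \<odot> q = q"
proof -
  have "closed_subsemigroup (\<^bold>*) ((\<lambda>x. x \<odot> e) ` I)"
    unfolding closed_subsemigroup_def
  proof (intro conjI ballI)
    show "uf_closed ((\<lambda>x. x \<odot> e) ` I)"
      using uf_closed_right_mult I e unfolding closed_subsemigroup_def by blast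
    show "(\<lambda>x. x \<odot> e) ` I \<noteq> {}" using I unfolding closed_subsemigroup_def by blast
    fix x y assume "x \<in> (\<lambda>x. x \<odot> e) ` I" "y \<in> (\<lambda>x. x \<odot> e) ` I"
    then obtain a b where ab: "a \<in> I" "b \<in> I" "x = a \<odot> e" "y = b \<odot> e" by blast
    then have "x \<odot> y = ((a \<odot> e) \<odot> b) \<odot> e" by (simp add: umult_assoc)
    moreover have "(a \<odot> e) \<odot> b \<in> I" using ideal I ab unfolding closed_subsemigroup_def by blast
    ultimately show "x \<odot> y \<in> (\<lambda>x. x \<odot> e) ` I" by blast
  qed
  then obtain r where r: "r \<in> (\<lambda>x. x \<odot> e) ` I" "r \<odot> r = r"
    using idempotent_exists by blast
  then obtain a where a: "a \<in> I" "r = a \<odot> e" by blast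
  have re: "r \<odot> e = r" unfolding a(2) umult_assoc e(2) ..
  show thesis
  proof (rule that[of "e \<odot> r"])
    show "e \<odot> r \<in> I" using a ideal by blast
    show "e \<odot> r \<odot> (e \<odot> r) = e \<odot> r"
    proof -
      have "e \<odot> r \<odot> (e \<odot> r) = e \<odot> (r \<odot> e) \<odot> r" by (simp add: umult_assoc)
      then show ?thesis by (simp add: re r(2) umult_assoc)
    qed
    show "e \<odot> r \<odot> e = e \<odot> r" using re by (simp add: umult_assoc)
    show "e \<odot> (e \<odot> r) = e \<odot> r" using e by (simp flip: umult_assoc)
  qed
qed

end

section \<open>Images of ultrafilters\<close>

text \<open>The carrier X is \<open>UNIV\<close> for substitution in words and \<open>PosN\<close>
  for evaluation of words.\<close>

definition push :: "'b set \<Rightarrow> ('a \<Rightarrow> 'b) \<Rightarrow> 'a set set \<Rightarrow> 'b set set" where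
  "push X h p = {A. A \<subseteq> X \<and> h -` A \<in> p}"

lemma ultrafilter_on_push:
  assumes "ultra p" "h -` X \<in> p"
  shows "ultrafilter_on X (push X h p)"
  unfolding ultrafilter_on_def
proof (intro conjI ballI allI impI)
  show "push X h p \<subseteq> Pow X" "X \<in> push X h p" "{} \<notin> push X h p"
    using assms(2) ultrafilter_on_nonempty[OF assms(1), of "{}"] by (auto simp: push_def)
  show "A \<inter> B \<in> push X h p" if "A \<in> push X h p" "B \<in> push X h p" for A B
    using that ultra_Int_iff[OF assms(1)] by (simp add: push_def le_infI1)
  show "B \<in> push X h p" if "A \<in> push X h p" "A \<subseteq> B \<and> B \<subseteq> X" for A B
    using that ultra_mono[OF assms(1) _ vimage_mono, of h A B] by (simp add: push_def)
  show "A \<in> push X h p \<or> X - A \<in> push X h p" if "A \<subseteq> X" for A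
    using that assms(2) ultra_Compl_iff[OF assms(1)] ultra_Int_iff[OF assms(1)]
    by (simp add: push_def Diff_eq vimage_Compl)
qed

lemma push_uf_mult:
  assumes "\<And>x y. h (f x y) = g (h x) (h y)"
  shows "push UNIV h (uf_mult f p q) = uf_mult g (push UNIV h p) (push UNIV h q)"
  by (simp add: push_def uf_mult_def vimage_def assms)

section \<open>Functions from an idempotent\<close>

lemma betaN_PosN: "p \<in> betaN \<Longrightarrow> PosN \<in> p"
  by (simp add: betaN_def ultrafilter_on_def)

lemma betaN_subset: "p \<in> betaN \<Longrightarrow> A \<in> p \<Longrightarrow> A \<subseteq> PosN"
  by (auto simp: betaN_def ultrafilter_on_def)

lemma betaN_mono: "p \<in> betaN \<Longrightarrow> A \<in> p \<Longrightarrow> A \<subseteq> B \<Longrightarrow> B \<subseteq> PosN \<Longrightarrow> B \<in> p"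
  unfolding betaN_def ultrafilter_on_def by blast

lemma betaN_Int: "p \<in> betaN \<Longrightarrow> A \<in> p \<Longrightarrow> B \<in> p \<Longrightarrow> A \<inter> B \<in> p"
  by (simp add: betaN_def ultrafilter_on_def)

lemma betaN_INT:
  assumes "p \<in> betaN" "finite I" "\<And>i. i \<in> I \<Longrightarrow> S i \<in> p"
  shows "PosN \<inter> (\<Inter>i\<in>I. S i) \<in> p"
  using assms(2,3)
proof (induction I)
  case empty
  then show ?case using betaN_PosN[OF assms(1)] by simp
next
  case (insert i I)
  then have "S i \<inter> (PosN \<inter> (\<Inter>i\<in>I. S i)) \<in> p" using betaN_Int[OF assms(1)] by simp
  then show ?case by (simp add: Int_left_commute)
qed

definition star :: "nat set set \<Rightarrow> nat set \<Rightarrow> nat set" where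
  "star p X = {x \<in> X. {y \<in> PosN. x + y \<in> X} \<in> p}"

lemma star_mem:
  assumes "p \<in> betaN" "uf_idempotent p" "X \<in> p"
  shows "star p X \<in> p"
proof -
  have X: "X \<subseteq> PosN" using assms betaN_subset by blast
  have "X \<in> uf_plus p p" using assms by (simp add: uf_idempotent_def)
  then have "X \<inter> {x \<in> PosN. {y \<in> PosN. x + y \<in> X} \<in> p} \<in> p"
    using assms betaN_Int by (simp add: uf_plus_def)
  moreover have "X \<inter> {x \<in> PosN. {y \<in> PosN. x + y \<in> X} \<in> p} = star p X"
    using X by (auto simp: star_def)
  ultimately show ?thesis by simp
qed

text \<open>The translate -x + X is in p, and so is its star set; by associativity that star set
  lies in -x + \<open>star p X\<close>. So a sum in the star set can be extended again and
  again.\<close>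

lemma star_shift_mem:
  assumes "p \<in> betaN" "uf_idempotent p" "x \<in> star p X"
  shows "{y \<in> PosN. x + y \<in> star p X} \<in> p"
proof -
  let ?Y = "{y \<in> PosN. x + y \<in> X}"
  have "?Y \<in> p" using assms(3) by (simp add: star_def)
  then have "star p ?Y \<in> p" using star_mem assms by blast
  moreover have "star p ?Y \<subseteq> {y \<in> PosN. x + y \<in> star p X}"
  proof
    fix y assume "y \<in> star p ?Y"
    then have y: "y \<in> PosN" "x + y \<in> X" "{z \<in> PosN. y + z \<in> ?Y} \<in> p"
      by (auto simp: star_def)
    have "{z \<in> PosN. y + z \<in> ?Y} = {z \<in> PosN. x + y + z \<in> X}"
      using y(1) by (auto simp: PosN_def add.assoc)
    then show "y \<in> {y \<in> PosN. x + y \<in> star p X}" using y by (simp add: star_def)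
  qed
  ultimately show ?thesis using betaN_mono[OF assms(1)] by blast
qed

section \<open>Tensor powers as trees\<close>

text \<open>With the value that \<open>tensor\<close> has at 0, one recursion equation holds for all
  k, and inductions can start at the empty tuple.\<close>

lemma tensor_Suc:
  "A \<in> tensor p (Suc k) \<longleftrightarrow> A \<subseteq> tuples (Suc k) \<and>
     {xs \<in> tuples k. {x \<in> PosN. xs @ [x] \<in> A} \<in> p (Suc k)} \<in> tensor p k"
proof (cases k)
  case 0
  have "{xs \<in> tuples 0. {x \<in> PosN. xs @ [x] \<in> A} \<in> p (Suc 0)} =
      (if {x \<in> PosN. [x] \<in> A} \<in> p (Suc 0) then {[]} else {})"
    by (auto simp: tuples_def)
  then show ?thesis by (simp add: 0)
qed simp

lemma tensor_mono:
  assumes "p \<in> betaN" "B \<in> tensor (\<lambda>i. p) k" "B \<subseteq> C" "C \<subseteq> tuples k"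
  shows "C \<in> tensor (\<lambda>i. p) k"
  using assms(2-4)
proof (induction k arbitrary: B C)
  case 0
  then show ?case by (auto simp: tuples_def)
next
  case (Suc k)
  have "{x \<in> PosN. xs @ [x] \<in> C} \<in> p" if "{x \<in> PosN. xs @ [x] \<in> B} \<in> p" for xs
    using that Suc.prems(2) by (elim betaN_mono[OF assms(1)]) auto
  then have "{xs \<in> tuples k. {x \<in> PosN. xs @ [x] \<in> B} \<in> p}
      \<subseteq> {xs \<in> tuples k. {x \<in> PosN. xs @ [x] \<in> C} \<in> p}" by blast
  from Suc.IH[OF _ this] Suc.prems show ?case unfolding tensor_Suc by blast
qed

text \<open>The recursion is unfolded from the last coordinate down: below m, \<open>B k\<close>
  consists of the k-tuples with p-many next entries leading into \<open>B (Suc k)\<close>. A tree of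
  height m replaces the nested quantifiers over p.\<close>

lemma tensor_sections:
  assumes "A \<in> tensor (\<lambda>i. p) m"
  obtains B where "B m = A" "[] \<in> B 0"
    "\<And>k xs. k < m \<Longrightarrow> xs \<in> B k \<Longrightarrow> {x \<in> PosN. xs @ [x] \<in> B (Suc k)} \<in> p"
proof -
  have "\<exists>B. B m = A \<and> [] \<in> B 0 \<and>
      (\<forall>k<m. \<forall>xs\<in>B k. {x \<in> PosN. xs @ [x] \<in> B (Suc k)} \<in> p)"
    using assms
  proof (induction m arbitrary: A)
    case (Suc m)
    let ?A = "{xs \<in> tuples m. {x \<in> PosN. xs @ [x] \<in> A} \<in> p}"
    obtain B where B: "B m = ?A" "[] \<in> B 0"
      "\<forall>k<m. \<forall>xs\<in>B k. {x \<in> PosN. xs @ [x] \<in> B (Suc k)} \<in> p"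
    proof -
      have "?A \<in> tensor (\<lambda>i. p) m" using Suc.prems by (simp only: tensor_Suc)
      from Suc.IH[OF this] show thesis by (elim exE conjE that)
    qed
    show ?case
      using B by (intro exI[of _ "B(Suc m := A)"]) (auto simp: less_Suc_eq)
  qed auto
  then show thesis using that by blast
qed

text \<open>
  A member \<open>xs\<close> of the set \<open>V\<close> is a partial output: its last entry is the block sum that is still
  being extended, which is why both appending a new entry and adding to the last one must be
  possible for \<open>p\<close>-many numbers.
\<close>
lemma idempotent_tensor_tree:
  assumes p: "p \<in> betaN" "uf_idempotent p" and A: "A \<in> tensor (\<lambda>i. p) m"
  obtains V where "[] \<in> V"
    "\<And>xs. xs \<in> V \<Longrightarrow> length xs = m \<Longrightarrow> xs \<in> A"
    "\<And>xs. xs \<in> V \<Longrightarrow> length xs < m \<Longrightarrow> {y \<in> PosN. xs @ [y] \<in> V} \<in> p"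
    "\<And>xs x. xs @ [x] \<in> V \<Longrightarrow> {y \<in> PosN. xs @ [x + y] \<in> V} \<in> p"
proof -
  obtain B where B: "B m = A" "[] \<in> B 0"
    "\<And>k xs. k < m \<Longrightarrow> xs \<in> B k \<Longrightarrow> {x \<in> PosN. xs @ [x] \<in> B (Suc k)} \<in> p"
    by (rule tensor_sections[OF A]) blast
  \<comment> \<open>\<open>C xs\<close> holds the next entries that the tree allows after xs. Taking
    the entries of V from the star sets of these is what permits enlarging the last entry, by
    \<open>star_shift_mem\<close>.\<close>
  define C where "C xs = {x \<in> PosN. xs @ [x] \<in> B (Suc (length xs))}" for xs
  define V where
    "V = {xs. length xs \<le> m \<and> (\<forall>k<length xs. xs ! k \<in> star p (C (take k xs)))}"
  have V_snoc: "xs @ [x] \<in> V \<longleftrightarrow> xs \<in> V \<and> length xs < m \<and> x \<in> star p (C xs)" for xs x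
    by (auto simp: V_def nth_append less_Suc_eq)
  have inB: "xs \<in> B (length xs)" if "xs \<in> V" for xs
  proof (cases xs rule: rev_cases)
    case (snoc ys y)
    then have "y \<in> star p (C ys)" using that V_snoc by simp
    then show ?thesis by (simp add: star_def C_def snoc)
  qed (use B in simp)
  show thesis
  proof (rule that[of V])
    show "[] \<in> V" by (simp add: V_def)
    show "xs \<in> A" if "xs \<in> V" "length xs = m" for xs
      using inB that B(1) by auto
    show "{y \<in> PosN. xs @ [y] \<in> V} \<in> p" if xs: "xs \<in> V" "length xs < m" for xs
    proof -
      have "C xs \<in> p" using B(3)[of "length xs" xs] inB xs by (simp add: C_def)
      then have "star p (C xs) \<in> p" using star_mem p by blast
      moreover have "star p (C xs) = {y \<in> PosN. xs @ [y] \<in> V}"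
        using xs by (auto simp: V_snoc) (auto simp: star_def C_def)
      ultimately show ?thesis by simp
    qed
    show "{y \<in> PosN. xs @ [x + y] \<in> V} \<in> p" if "xs @ [x] \<in> V" for xs x
      using that star_shift_mem[OF p, of x "C xs"] by (simp add: V_snoc)
  qed
qed

section \<open>J-sets and the recursive choice of \<alpha> and H\<close>

text \<open>The J-set property is applied to the translates f(t + n), and the set B found for them
  is moved up by n. This is how values of H are placed after all earlier ones.\<close>

lemma J_set_late:
  assumes "J_set A" "F \<in> Pf PosFun"
  shows "\<exists>a\<in>PosN. \<exists>B\<in>Pf PosN. n < Min B \<and> (\<forall>f\<in>F. a + (\<Sum>t\<in>B. f t) \<in> A)"
proof -
  \<comment> \<open>Restriction to \<open>PosN\<close> fixes the value at 0, as the extensional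
    space \<open>PosFun\<close> demands.\<close>
  define sh where "sh f = (\<lambda>t\<in>PosN. f (t + n))" for f :: "nat \<Rightarrow> nat"
  have "sh f \<in> PosFun" if "f \<in> PosFun" for f
  proof -
    have "f (t + n) \<in> PosN" if "t \<in> PosN" for t
      using \<open>f \<in> PosFun\<close> that by (auto simp: PosFun_def PosN_def)
    then show ?thesis by (simp add: PosFun_def sh_def)
  qed
  then have F: "sh ` F \<in> Pf PosFun"
    using assms(2) by (auto simp: Pf_def)
  have "\<forall>F\<in>Pf PosFun. \<exists>a\<in>PosN. \<exists>B\<in>Pf PosN. \<forall>f\<in>F. a + (\<Sum>t\<in>B. f t) \<in> A"
    using assms(1) by (simp add: J_set_def)
  from bspec[OF this F] obtain a B
    where aB: "a \<in> PosN" "B \<in> Pf PosN" "\<forall>f\<in>F. a + (\<Sum>t\<in>B. sh f t) \<in> A"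
    unfolding ball_simps by blast
  let ?B = "(\<lambda>t. t + n) ` B"
  have B: "?B \<in> Pf PosN"
    using aB(2) by (auto simp: Pf_def PosN_def)
  have "n < Min ?B"
    using aB(2) by (subst Min_gr_iff) (auto simp: Pf_def PosN_def)
  moreover have "(\<Sum>t\<in>?B. f t) = (\<Sum>t\<in>B. sh f t)" for f
    using aB(2) by (subst sum.reindex) (auto simp: sh_def Pf_def intro!: sum.cong)
  ultimately have "n < Min ?B \<and> (\<forall>f\<in>F. a + (\<Sum>t\<in>?B. f t) \<in> A)" using aB(3) by simp
  then show ?thesis using aB(1) B by blast
qed

text \<open>The first statement of the equivalence under a name, so that each implication can be
  stated separately.\<close>

definition ramsey_functions ::
  "nat \<Rightarrow> nat list set \<Rightarrow> ((nat \<Rightarrow> nat) set \<Rightarrow> nat) \<Rightarrow> ((nat \<Rightarrow> nat) set \<Rightarrow> nat set) \<Rightarrow> bool" where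
  "ramsey_functions m A \<alpha> H \<longleftrightarrow>
     \<alpha> \<in> Pf PosFun \<rightarrow> PosN \<and> H \<in> Pf PosFun \<rightarrow> Pf PosN \<and>
     (\<forall>F \<in> Pf PosFun. \<forall>G \<in> Pf PosFun. F \<subset> G \<longrightarrow> set_before (H F) (H G)) \<and>
     (\<forall>G :: nat \<Rightarrow> (nat \<Rightarrow> nat) set.
        (\<forall>i\<in>PosN. G i \<in> Pf PosFun) \<and> (\<forall>i\<in>PosN. G i \<subset> G (i + 1)) \<longrightarrow>
        (\<forall>(\<beta> :: nat \<Rightarrow> nat set) (f :: nat \<Rightarrow> nat \<Rightarrow> nat).
           (\<forall>j\<in>{1..m}. \<beta> j \<in> Pf PosN) \<and>
           (\<forall>j\<in>{1..<m}. set_before (\<beta> j) (\<beta> (j + 1))) \<and>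
           (\<forall>i\<in>PosN. f i \<in> G i) \<longrightarrow>
           map (\<lambda>j. \<Sum>i\<in>\<beta> j. (\<alpha> (G i) + (\<Sum>t\<in>H (G i). f i t))) [1..<m + 1] \<in> A))"

text \<open>
  \<open>R F\<close> collects the partial outputs of the chains ending in \<open>F\<close>; carrying it along in the recursion
  avoids quantifying over chains.
\<close>
lemma J_idempotent_state_functions:
  assumes p: "p \<in> J_ultrafilters" "uf_idempotent p" and nil: "[] \<in> V"
    and V: "\<And>xs. xs \<in> V \<Longrightarrow> length xs < m \<Longrightarrow> {y \<in> PosN. xs @ [y] \<in> V} \<in> p"
    "\<And>xs x. xs @ [x] \<in> V \<Longrightarrow> {y \<in> PosN. xs @ [x + y] \<in> V} \<in> p"
  obtains \<alpha> H R where "\<And>F. F \<in> Pf PosFun \<Longrightarrow> \<alpha> F \<in> PosN"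
    "\<And>F. F \<in> Pf PosFun \<Longrightarrow> H F \<in> Pf PosN"
    "\<And>F G. F \<in> Pf PosFun \<Longrightarrow> G \<in> Pf PosFun \<Longrightarrow> F \<subset> G \<Longrightarrow> set_before (H F) (H G)"
    "\<And>F. F \<in> Pf PosFun \<Longrightarrow> R F \<subseteq> V"
    "\<And>F g xs. F \<in> Pf PosFun \<Longrightarrow> g \<in> F \<Longrightarrow> length xs < m \<Longrightarrow>
       xs = [] \<or> (\<exists>G. G \<in> Pf PosFun \<and> G \<subset> F \<and> xs \<in> R G) \<Longrightarrow>
       xs @ [\<alpha> F + (\<Sum>t\<in>H F. g t)] \<in> R F"
    "\<And>F g xs x G. F \<in> Pf PosFun \<Longrightarrow> g \<in> F \<Longrightarrow> G \<in> Pf PosFun \<Longrightarrow> G \<subset> F \<Longrightarrow>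
       xs @ [x] \<in> R G \<Longrightarrow> xs @ [x + (\<alpha> F + (\<Sum>t\<in>H F. g t))] \<in> R F"
proof -
  \<comment> \<open>The recursion produces the triple of \<alpha> F, H F and R F at once.
    \<open>past\<close> collects the outputs below F and the empty tuple, from which a chain may
    start at any F; \<open>ok\<close> is vacuous for F outside \<open>Pf PosFun\<close>.\<close>
  define val :: "nat \<times> nat set \<times> nat list set \<Rightarrow> (nat \<Rightarrow> nat) \<Rightarrow> nat"
    where "val s g = fst s + (\<Sum>t\<in>fst (snd s). g t)" for s g
  define below where "below F = {G \<in> Pf PosFun. G \<subset> F}" for F
  define past :: "((nat \<Rightarrow> nat) set \<Rightarrow> nat \<times> nat set \<times> nat list set) \<Rightarrow> (nat \<Rightarrow> nat) set \<Rightarrow> nat list set"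
    where "past s F = insert [] (\<Union>G\<in>below F. snd (snd (s G)))" for s F
  define ok where "ok s F r \<longleftrightarrow> (F \<in> Pf PosFun \<longrightarrow>
      fst r \<in> PosN \<and> fst (snd r) \<in> Pf PosN \<and>
      (\<forall>G\<in>below F. set_before (fst (snd (s G))) (fst (snd r))) \<and>
      finite (snd (snd r)) \<and> snd (snd r) \<subseteq> V \<and>
      (\<forall>xs\<in>past s F. \<forall>g\<in>F. (length xs < m \<longrightarrow> xs @ [val r g] \<in> snd (snd r)) \<and>
         (xs \<noteq> [] \<longrightarrow> butlast xs @ [last xs + val r g] \<in> snd (snd r))))" for s F r
  have pb: "p \<in> betaN" using p by (simp add: J_ultrafilters_def)
  \<comment> \<open>Strict inclusion in finite sets is well-founded, and \<open>ok\<close> looks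
    only at values of s strictly below F.\<close>
  have "\<exists>s. \<forall>F. ok s F (s F)"
  proof (rule dependent_wf_choice[OF wf_finite_psubset])
    fix s t :: "(nat \<Rightarrow> nat) set \<Rightarrow> nat \<times> nat set \<times> nat list set" and F r
    assume eq: "\<And>G. (G, F) \<in> finite_psubset \<Longrightarrow> s G = t G"
    show "ok s F r = ok t F r"
    proof (cases "F \<in> Pf PosFun")
      case True
      then have "s G = t G" if "G \<in> below F" for G
        using eq that by (simp add: below_def finite_psubset_def Pf_def)
      then show ?thesis by (simp add: ok_def past_def)
    qed (simp add: ok_def)
  next
    fix F s assume IH: "\<And>G. (G, F) \<in> finite_psubset \<Longrightarrow> ok s G (s G)"
    show "\<exists>r. ok s F r"
    proof (cases "F \<in> Pf PosFun")
      case False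
      then show ?thesis by (simp add: ok_def)
    next
      case F: True
      then have finF: "finite F" by (simp add: Pf_def)
      have "below F \<subseteq> Pow F" by (auto simp: below_def)
      then have fb: "finite (below F)" using finF finite_subset by blast
      have okG: "finite (snd (snd (s G)))" "snd (snd (s G)) \<subseteq> V" if "G \<in> below F" for G
        using IH[of G] that finF by (auto simp: below_def finite_psubset_def ok_def)
      have past: "finite (past s F)" "past s F \<subseteq> V"
        using fb okG nil by (auto simp: past_def)
      \<comment> \<open>Increments y for which both moves, opening a new block with y and adding y
        to the last block, stay in V. As the past is finite, the intersection of these sets is in p
        and therefore a J-set.\<close>
      define D where "D xs = {y \<in> PosN. (length xs < m \<longrightarrow> xs @ [y] \<in> V) \<and>
          (xs \<noteq> [] \<longrightarrow> butlast xs @ [last xs + y] \<in> V)}" for xs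
      have D: "D xs \<in> p" if "xs \<in> past s F" for xs
      proof -
        have xs: "xs \<in> V" using that past by blast
        let ?X = "if length xs < m then {y \<in> PosN. xs @ [y] \<in> V} else PosN"
        let ?Y = "if xs \<noteq> [] then {y \<in> PosN. butlast xs @ [last xs + y] \<in> V} else PosN"
        have "?X \<in> p" using V(1) xs betaN_PosN[OF pb] by simp
        moreover have "?Y \<in> p" using V(2)[of "butlast xs" "last xs"] xs betaN_PosN[OF pb] by simp
        ultimately have "?X \<inter> ?Y \<in> p" using betaN_Int[OF pb] by blast
        moreover have "?X \<inter> ?Y = D xs" by (auto simp: D_def)
        ultimately show ?thesis by simp
      qed
      have J: "J_set (PosN \<inter> (\<Inter>xs\<in>past s F. D xs))"
        using betaN_INT[OF pb past(1) D] p(1) by (auto simp: J_ultrafilters_def)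
      \<comment> \<open>Choosing B beyond this bound puts H F after H G for every G below F.\<close>
      obtain n where n: "\<And>G. G \<in> below F \<Longrightarrow> Max (fst (snd (s G))) \<le> n"
        using finite_imageI[OF fb, of "\<lambda>G. Max (fst (snd (s G)))"]
        by (auto simp: finite_nat_set_iff_bounded_le)
      obtain a B where aB: "a \<in> PosN" "B \<in> Pf PosN" "n < Min B"
        and "\<forall>g\<in>F. a + (\<Sum>t\<in>B. g t) \<in> PosN \<inter> (\<Inter>xs\<in>past s F. D xs)"
        using J_set_late[OF J F, of n] by (elim bexE conjE)
      then have inD: "a + (\<Sum>t\<in>B. g t) \<in> D xs" if "g \<in> F" "xs \<in> past s F" for g xs
        using that by simp
      define R where "R = (\<lambda>(xs, g). xs @ [a + (\<Sum>t\<in>B. g t)]) ` ({xs \<in> past s F. length xs < m} \<times> F) \<union>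
        (\<lambda>(xs, g). butlast xs @ [last xs + (a + (\<Sum>t\<in>B. g t))]) ` ({xs \<in> past s F. xs \<noteq> []} \<times> F)"
      have "ok s F (a, B, R)"
        unfolding ok_def
      proof (intro impI conjI ballI)
        show "fst (a, B, R) \<in> PosN" "fst (snd (a, B, R)) \<in> Pf PosN" using aB by simp_all
        show "set_before (fst (snd (s G))) (fst (snd (a, B, R)))" if "G \<in> below F" for G
          using n[OF that] aB(3) by (simp add: set_before_def)
        show "finite (snd (snd (a, B, R)))" using past(1) finF by (simp add: R_def)
        show "snd (snd (a, B, R)) \<subseteq> V" using inD by (auto simp: R_def D_def)
        show "xs @ [val (a, B, R) g] \<in> snd (snd (a, B, R))"
          if "xs \<in> past s F" "g \<in> F" "length xs < m" for xs g
          using that by (auto simp: val_def R_def)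
        show "butlast xs @ [last xs + val (a, B, R) g] \<in> snd (snd (a, B, R))"
          if "xs \<in> past s F" "g \<in> F" "xs \<noteq> []" for xs g
          using that by (auto simp: val_def R_def intro!: image_eqI[of _ _ "(xs, g)"])
      qed
      then show ?thesis ..
    qed
  qed
  then obtain s where s: "\<And>F. ok s F (s F)" by blast
  show thesis
  proof (rule that[of "\<lambda>F. fst (s F)" "\<lambda>F. fst (snd (s F))" "\<lambda>F. snd (snd (s F))"])
    fix F assume F: "F \<in> Pf PosFun"
    show "fst (s F) \<in> PosN" "fst (snd (s F)) \<in> Pf PosN" "snd (snd (s F)) \<subseteq> V"
      using s[of F] F by (simp_all add: ok_def)
    fix G assume G: "G \<in> Pf PosFun"
    show "set_before (fst (snd (s F))) (fst (snd (s G)))" if "F \<subset> G"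
      using s[of G] F G that by (simp add: ok_def below_def)
  next
    fix F g xs assume F: "F \<in> Pf PosFun" "g \<in> F" "length xs < m"
      and xs: "xs = [] \<or> (\<exists>G. G \<in> Pf PosFun \<and> G \<subset> F \<and> xs \<in> snd (snd (s G)))"
    have "xs \<in> past s F" using xs by (auto simp: past_def below_def)
    then show "xs @ [fst (s F) + (\<Sum>t\<in>fst (snd (s F)). g t)] \<in> snd (snd (s F))"
      using s[of F] F by (simp add: ok_def val_def)
  next
    fix F g xs x G assume F: "F \<in> Pf PosFun" "g \<in> F"
      and G: "G \<in> Pf PosFun" "G \<subset> F" "xs @ [x] \<in> snd (snd (s G))"
    have "xs @ [x] \<in> past s F" using G by (auto simp: past_def below_def)
    then show "xs @ [x + (fst (s F) + (\<Sum>t\<in>fst (snd (s F)). g t))] \<in> snd (snd (s F))"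
      using s[of F] F unfolding ok_def val_def by fastforce
  qed
qed

text \<open>Along a chain, the tuple of sums of the blocks processed so far stays in
  \<open>R (G i)\<close>, with i the last index used: opening a block appends an entry, and every
  further index adds to the last one. R lies inside V, whose m-tuples belong to A.\<close>

lemma J_idempotent_imp_ramsey_functions:
  assumes m: "0 < m" and p: "p \<in> J_ultrafilters" "uf_idempotent p" and A: "A \<in> tensor (\<lambda>i. p) m"
  shows "\<exists>\<alpha> H. ramsey_functions m A \<alpha> H"
proof -
  have pb: "p \<in> betaN" using p by (simp add: J_ultrafilters_def)
  obtain V where V: "[] \<in> V" "\<And>xs. xs \<in> V \<Longrightarrow> length xs = m \<Longrightarrow> xs \<in> A"
    "\<And>xs. xs \<in> V \<Longrightarrow> length xs < m \<Longrightarrow> {y \<in> PosN. xs @ [y] \<in> V} \<in> p"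
    "\<And>xs x. xs @ [x] \<in> V \<Longrightarrow> {y \<in> PosN. xs @ [x + y] \<in> V} \<in> p"
    by (rule idempotent_tensor_tree[OF pb p(2) A]) blast
  obtain \<alpha> H R where \<alpha>: "\<And>F. F \<in> Pf PosFun \<Longrightarrow> \<alpha> F \<in> PosN"
    and H: "\<And>F. F \<in> Pf PosFun \<Longrightarrow> H F \<in> Pf PosN"
      "\<And>F G. F \<in> Pf PosFun \<Longrightarrow> G \<in> Pf PosFun \<Longrightarrow> F \<subset> G \<Longrightarrow> set_before (H F) (H G)"
    and R: "\<And>F. F \<in> Pf PosFun \<Longrightarrow> R F \<subseteq> V"
    and new: "\<And>F g xs. F \<in> Pf PosFun \<Longrightarrow> g \<in> F \<Longrightarrow> length xs < m \<Longrightarrow>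
       xs = [] \<or> (\<exists>G. G \<in> Pf PosFun \<and> G \<subset> F \<and> xs \<in> R G) \<Longrightarrow>
       xs @ [\<alpha> F + (\<Sum>t\<in>H F. g t)] \<in> R F"
    and ext: "\<And>F g xs x G. F \<in> Pf PosFun \<Longrightarrow> g \<in> F \<Longrightarrow> G \<in> Pf PosFun \<Longrightarrow> G \<subset> F \<Longrightarrow>
       xs @ [x] \<in> R G \<Longrightarrow> xs @ [x + (\<alpha> F + (\<Sum>t\<in>H F. g t))] \<in> R F"
    by (rule J_idempotent_state_functions[OF p V(1,3,4)]) blast+
  have main: "map (\<lambda>j. \<Sum>i\<in>\<beta> j. (\<alpha> (G i) + (\<Sum>t\<in>H (G i). f i t))) [1..<m + 1] \<in> A"
    if G: "\<forall>i\<in>PosN. G i \<in> Pf PosFun" "\<forall>i\<in>PosN. G i \<subset> G (i + 1)"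
      and \<beta>: "\<forall>j\<in>{1..m}. \<beta> j \<in> Pf PosN" "\<forall>j\<in>{1..<m}. set_before (\<beta> j) (\<beta> (j + 1))"
      and f: "\<forall>i\<in>PosN. f i \<in> G i" for G \<beta> f
  proof -
    define y where "y i = \<alpha> (G i) + (\<Sum>t\<in>H (G i). f i t)" for i
    \<comment> \<open>Blocks may skip indices, so inclusion is needed for any two positions of the
      chain.\<close>
    have mono: "G i \<subset> G j" if "i \<in> PosN" "i < j" for i j
      using that(2,1)
    proof (induction j)
      case (Suc j)
      then have "j \<in> PosN" by (auto simp: PosN_def)
      then have "G j \<subset> G (Suc j)" using G by simp
      then show ?case using Suc by (metis less_antisym psubset_trans)
    qed simp
    \<comment> \<open>Induction on the largest index: the least index of b opens the block through
      \<open>new\<close>, all later ones extend it through \<open>ext\<close>.\<close>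
    have block: "xs @ [sum y b] \<in> R (G (Max b))"
      if "finite b" "b \<noteq> {}" "b \<subseteq> PosN" "length xs < m"
        "xs = [] \<or> (\<exists>l\<in>PosN. (\<forall>i\<in>b. l < i) \<and> xs \<in> R (G l))" for xs b
      using that
    proof (induction b rule: finite_linorder_max_induct)
      case (insert M b)
      have M: "Max (insert M b) = M" using insert by (intro Max_eqI) auto
      have "M \<in> PosN" using insert.prems by simp
      then have GM: "G M \<in> Pf PosFun" "f M \<in> G M" using G f by auto
      show ?case
      proof (cases "b = {}")
        case True
        have "xs = [] \<or> (\<exists>G'. G' \<in> Pf PosFun \<and> G' \<subset> G M \<and> xs \<in> R G')"
        proof (cases "xs = []")
          case False
          then obtain l where l: "l \<in> PosN" "l < M" "xs \<in> R (G l)"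
            using insert.prems(4) by auto
          then show ?thesis using mono[OF l(1,2)] G(1) by blast
        qed simp
        then show ?thesis using new[OF GM insert.prems(3)] M True by (simp add: y_def)
      next
        case False
        have b: "xs @ [sum y b] \<in> R (G (Max b))"
          using False insert.prems by (intro insert.IH) auto
        have "Max b \<in> b" using insert.hyps False by simp
        then have l: "Max b \<in> PosN" "Max b < M" using insert.hyps insert.prems by auto
        have "xs @ [sum y b + y M] \<in> R (G M)"
          unfolding y_def[of M] using G(1) l by (intro ext[OF GM _ mono[OF l] b]) blast
        moreover have "sum y (insert M b) = sum y b + y M"
          using insert.hyps by (subst sum.insert) auto
        ultimately show ?thesis using M by simp
      qed
    qed simp
    \<comment> \<open>The case k = 0 is separate because no last index exists yet.\<close>
    have "k = 0 \<or> map (\<lambda>j. sum y (\<beta> j)) [1..<k + 1] \<in> R (G (Max (\<beta> k)))" if "k \<le> m" for k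
      using that
    proof (induction k)
      case (Suc k)
      let ?xs = "map (\<lambda>j. sum y (\<beta> j)) [1..<k + 1]"
      have b: "finite (\<beta> (Suc k))" "\<beta> (Suc k) \<noteq> {}" "\<beta> (Suc k) \<subseteq> PosN"
        using \<beta>(1) Suc.prems by (auto simp: Pf_def)
      have "?xs = [] \<or> (\<exists>l\<in>PosN. (\<forall>i\<in>\<beta> (Suc k). l < i) \<and> ?xs \<in> R (G l))"
      proof (cases "k = 0")
        case False
        then have bk: "\<beta> k \<in> Pf PosN" "set_before (\<beta> k) (\<beta> (Suc k))" using \<beta> Suc.prems by auto
        have "Max (\<beta> k) \<in> \<beta> k" using bk(1) by (intro Max_in) (auto simp: Pf_def)
        then have "Max (\<beta> k) \<in> PosN" using bk(1) unfolding Pf_def by blast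
        moreover have "\<forall>i\<in>\<beta> (Suc k). Max (\<beta> k) < i"
          using b bk by (auto simp: set_before_def Pf_def simp del: Max_less_iff)
        ultimately show ?thesis using Suc False by auto
      qed simp
      then have "?xs @ [sum y (\<beta> (Suc k))] \<in> R (G (Max (\<beta> (Suc k))))"
        using block[OF b] Suc.prems by simp
      then show ?case by simp
    qed simp
    then have "map (\<lambda>j. sum y (\<beta> j)) [1..<m + 1] \<in> R (G (Max (\<beta> m)))" using m by blast
    moreover have "\<beta> m \<in> Pf PosN" using \<beta>(1) m by simp
    then have "Max (\<beta> m) \<in> PosN" using Max_in[of "\<beta> m"] unfolding Pf_def by blast
    ultimately have "map (\<lambda>j. sum y (\<beta> j)) [1..<m + 1] \<in> V" using R G(1) by blast
    then show ?thesis using V(2) by (simp add: y_def)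
  qed
  have "ramsey_functions m A \<alpha> H"
    unfolding ramsey_functions_def
  proof (intro conjI allI impI ballI)
    show "\<alpha> \<in> Pf PosFun \<rightarrow> PosN" "H \<in> Pf PosFun \<rightarrow> Pf PosN" using \<alpha> H(1) by (auto intro: funcsetI)
  qed (use H(2) main in simp_all)
  then show ?thesis by blast
qed

section \<open>Words and an idempotent from functions\<close>

type_synonym word = "((nat \<Rightarrow> nat) set \<times> (nat \<Rightarrow> nat) option) list"

text \<open>The letter \<open>None\<close> is the variable. That every G lies strictly above F has
  two uses: each f in F may replace the variable anywhere, and a word above the support of another
  can be appended to it.\<close>

definition chain_words :: "(nat \<Rightarrow> nat) set \<Rightarrow> word set" where
  "chain_words F = {w. w \<noteq> [] \<and> sorted_wrt (\<subset>) (map fst w) \<and>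
     (\<forall>(G, c)\<in>set w. F \<subset> G \<and> G \<in> Pf PosFun \<and> (\<forall>g. c = Some g \<longrightarrow> g \<in> G))}"

definition const_words :: "word set" where
  "const_words = {w. None \<notin> snd ` set w}"

text \<open>On a chain word this is the largest set that occurs.\<close>

definition support :: "word \<Rightarrow> (nat \<Rightarrow> nat) set" where
  "support w = \<Union>(fst ` set w)"

definition subst :: "(nat \<Rightarrow> nat) \<Rightarrow> word \<Rightarrow> word" where
  "subst f w = map (\<lambda>(G, c). (G, Some (case c of None \<Rightarrow> f | Some g \<Rightarrow> g))) w"

lemma chain_wordsI:
  assumes "w \<noteq> []" "sorted_wrt (\<subset>) (map fst w)"
    and "\<And>G c. (G, c) \<in> set w \<Longrightarrow> F \<subset> G \<and> G \<in> Pf PosFun \<and> (\<forall>g. c = Some g \<longrightarrow> g \<in> G)"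
  shows "w \<in> chain_words F"
  using assms unfolding chain_words_def by auto

lemma chain_wordsD:
  assumes "w \<in> chain_words F"
  shows "w \<noteq> []" "sorted_wrt (\<subset>) (map fst w)"
    and "(G, c) \<in> set w \<Longrightarrow> F \<subset> G \<and> G \<in> Pf PosFun \<and> (\<forall>g. c = Some g \<longrightarrow> g \<in> G)"
  using assms unfolding chain_words_def by auto

lemma chain_words_fst:
  assumes "w \<in> chain_words F" "G \<in> fst ` set w"
  shows "F \<subset> G" "G \<in> Pf PosFun"
proof -
  obtain c where "(G, c) \<in> set w" using assms(2) by auto
  then show "F \<subset> G" "G \<in> Pf PosFun"
    using chain_wordsD(3)[OF assms(1)] by blast+
qed

lemma subst_append: "subst f (w @ v) = subst f w @ subst f v"
  by (simp add: subst_def)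

lemma subst_const: "w \<in> const_words \<Longrightarrow> subst f w = w"
  unfolding subst_def
  by (rule map_idI) (auto simp: const_words_def image_iff split: option.splits)

text \<open>Concatenation is associative on all lists but keeps chains only if v starts above w.
  Ultrafilters concentrated above every finite set of functions meet this for almost all v.\<close>

lemma chain_words_append:
  assumes "w \<in> chain_words F" "v \<in> chain_words (F \<union> support w)"
  shows "w @ v \<in> chain_words F"
proof -
  have "G \<subset> G'" if "G \<in> fst ` set w" "G' \<in> fst ` set v" for G G'
  proof -
    have "G \<subseteq> support w" using that(1) by (auto simp: support_def)
    moreover have "F \<union> support w \<subset> G'" by (rule chain_words_fst[OF assms(2) that(2)])
    ultimately show ?thesis by blast
  qed
  then have "\<forall>x\<in>set (map fst w). \<forall>y\<in>set (map fst v). x \<subset> y"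
    unfolding set_map by blast
  then have "sorted_wrt (\<subset>) (map fst (w @ v))"
    using assms by (simp add: chain_words_def sorted_wrt_append)
  moreover have "F \<subset> G \<and> G \<in> Pf PosFun \<and> (\<forall>g. c = Some g \<longrightarrow> g \<in> G)"
    if "(G, c) \<in> set (w @ v)" for G c
  proof (cases "(G, c) \<in> set w")
    case True
    then show ?thesis by (rule chain_wordsD(3)[OF assms(1)])
  next
    case False
    then have "(G, c) \<in> set v" using that by simp
    from chain_wordsD(3)[OF assms(2) this] show ?thesis by blast
  qed
  ultimately show ?thesis
    using chain_wordsD(1)[OF assms(1)] by (intro chain_wordsI) auto
qed

lemma chain_words_antimono:
  assumes "F \<subseteq> F'"
  shows "chain_words F' \<subseteq> chain_words F"
proof
  fix w assume w: "w \<in> chain_words F'"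
  show "w \<in> chain_words F"
    using chain_wordsD[OF w] subset_psubset_trans[OF assms] by (intro chain_wordsI) blast+
qed

lemma subst_chain_words:
  assumes "w \<in> chain_words F" "f \<in> F"
  shows "subst f w \<in> chain_words F \<inter> const_words"
proof -
  have "map fst (subst f w) = map fst w" by (auto simp: subst_def)
  moreover have "F \<subset> G \<and> G \<in> Pf PosFun \<and> (\<forall>g. c = Some g \<longrightarrow> g \<in> G)"
    if Gc: "(G, c) \<in> set (subst f w)" for G c
  proof -
    obtain c' where c': "(G, c') \<in> set w" "c = Some (case c' of None \<Rightarrow> f | Some g \<Rightarrow> g)"
      using Gc by (auto simp: subst_def)
    then have "F \<subset> G \<and> G \<in> Pf PosFun \<and> (\<forall>g. c' = Some g \<longrightarrow> g \<in> G)"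
      using chain_wordsD(3)[OF assms(1)] by blast
    then show ?thesis
      using c'(2) assms(2) by (auto split: option.splits)
  qed
  moreover have "subst f w \<noteq> []" using chain_wordsD(1)[OF assms(1)] by (simp add: subst_def)
  ultimately have "subst f w \<in> chain_words F"
    using chain_wordsD(2)[OF assms(1)] by (intro chain_wordsI) simp_all
  moreover have "subst f w \<in> const_words" by (auto simp: subst_def const_words_def)
  ultimately show ?thesis by blast
qed

text \<open>Constant functions suffice. Infinity is what allows every finite set of functions to be
  enlarged strictly.\<close>

lemma infinite_PosFun: "infinite PosFun"
proof -
  have Suc: "(\<lambda>t\<in>PosN. Suc n) \<in> PosFun" for n
    unfolding PosFun_def by (rule restrict_PiE[THEN iffD2]) (simp add: PosN_def)
  have "inj (\<lambda>n. \<lambda>t\<in>PosN. Suc n)"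
  proof (rule injI)
    fix m n assume "(\<lambda>t\<in>PosN. Suc m) = (\<lambda>t\<in>PosN. Suc n)"
    from fun_cong[OF this, of 1] show "m = n" by (simp add: PosN_def)
  qed
  moreover have "range (\<lambda>n. \<lambda>t\<in>PosN. Suc n) \<subseteq> PosFun"
    using Suc by blast
  ultimately show ?thesis using infinite_iff_countable_subset by blast
qed

lemma Pf_PosFun_above:
  assumes "finite F" "F \<subseteq> PosFun"
  obtains G g where "F \<subset> G" "G \<in> Pf PosFun" "g \<in> G"
proof -
  have "\<not> PosFun \<subseteq> F" using infinite_PosFun assms finite_subset by blast
  then obtain g where "g \<in> PosFun" "g \<notin> F" by blast
  then show thesis using assms by (intro that[of "insert g F" g]) (auto simp: Pf_def)
qed

lemma chain_words_nonempty:
  assumes "finite F" "F \<subseteq> PosFun"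
  shows "chain_words F \<inter> const_words \<noteq> {}" "chain_words F \<inter> - const_words \<noteq> {}"
proof -
  obtain G g where G: "F \<subset> G" "G \<in> Pf PosFun" "g \<in> G"
    using Pf_PosFun_above[OF assms] by blast
  have "[(G, Some g)] \<in> chain_words F \<inter> const_words" "[(G, None)] \<in> chain_words F \<inter> - const_words"
    using G by (auto simp: chain_words_def const_words_def)
  then show "chain_words F \<inter> const_words \<noteq> {}" "chain_words F \<inter> - const_words \<noteq> {}"
    by blast+
qed

section \<open>Ultrafilters on words\<close>

text \<open>The words above F are the tails of a partial semigroup; containing all tails makes
  products by concatenation respect chains. K restricts to constant words or to words with a
  variable.\<close>

definition word_ultras :: "word set \<Rightarrow> word set set set" where
  "word_ultras K = {u. ultra u \<and> (\<forall>F. finite F \<longrightarrow> F \<subseteq> PosFun \<longrightarrow> chain_words F \<inter> K \<in> u)}"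

lemma word_ultras_ultra: "u \<in> word_ultras K \<Longrightarrow> ultra u"
  by (simp add: word_ultras_def)

lemma word_ultras_chain:
  "u \<in> word_ultras K \<Longrightarrow> finite F \<Longrightarrow> F \<subseteq> PosFun \<Longrightarrow> chain_words F \<inter> K \<in> u"
  by (simp add: word_ultras_def)

lemma word_ultras_closed: "uf_closed (word_ultras K)"
  by (rule uf_closedI[of _ "{chain_words F \<inter> K |F. finite F \<and> F \<subseteq> PosFun}"])
    (auto simp: word_ultras_def)

text \<open>The tails are directed: words above the union of finitely many sets are above each of
  them.\<close>

lemma word_ultras_nonempty:
  assumes "\<And>F. finite F \<Longrightarrow> F \<subseteq> PosFun \<Longrightarrow> chain_words F \<inter> K \<noteq> {}"
  shows "word_ultras K \<noteq> {}"
proof -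
  let ?c = "\<lambda>F. chain_words F \<inter> K"
  have "has_fip (?c ` {F. finite F \<and> F \<subseteq> PosFun})"
    unfolding has_fip_def
  proof (intro allI impI)
    fix \<G> assume G: "finite \<G>" "\<G> \<subseteq> ?c ` {F. finite F \<and> F \<subseteq> PosFun}"
    from finite_subset_image[OF G] obtain \<H>
      where H: "\<H> \<subseteq> {F. finite F \<and> F \<subseteq> PosFun}" "finite \<H>" "\<G> = ?c ` \<H>"
      by (elim exE conjE)
    have "?c (\<Union>\<H>) \<subseteq> \<Inter>\<G>"
      using chain_words_antimono[OF Union_upper] unfolding H(3) by blast
    moreover have "?c (\<Union>\<H>) \<noteq> {}" using H by (intro assms) auto
    ultimately show "\<Inter>\<G> \<noteq> {}" by blast
  qed
  from ultra_extend[OF this] obtain u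
    where "ultra u" "?c ` {F. finite F \<and> F \<subseteq> PosFun} \<subseteq> u" by (elim exE conjE)
  then have "u \<in> word_ultras K" by (auto simp: word_ultras_def)
  then show ?thesis by blast
qed

text \<open>For fixed x the support is finite, so v contains the tail above F and
  \<open>support x\<close>, and all words in it can be appended to x. The three sets of words make
  this cover semigroup and ideal properties alike.\<close>

lemma word_ultras_mult:
  assumes u: "u \<in> word_ultras K" and v: "v \<in> word_ultras K'"
    and K: "\<And>x y. x \<in> K \<Longrightarrow> y \<in> K' \<Longrightarrow> x @ y \<in> L"
  shows "uf_mult (@) u v \<in> word_ultras L"
  unfolding word_ultras_def
proof (intro CollectI conjI allI impI)
  note uu = word_ultras_ultra[OF u] and uv = word_ultras_ultra[OF v]
  show "ultra (uf_mult (@) u v)" using ultra_uf_mult uu uv by blast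
  fix F :: "(nat \<Rightarrow> nat) set" assume F: "finite F" "F \<subseteq> PosFun"
  have "{y. x @ y \<in> chain_words F \<inter> L} \<in> v" if x: "x \<in> chain_words F \<inter> K" for x
  proof (rule ultra_mono[OF uv])
    have "finite G \<and> G \<subseteq> PosFun" if "G \<in> fst ` set x" for G
      using chain_words_fst(2)[OF IntD1[OF x] that] by (simp add: Pf_def)
    then have "finite (support x)" "support x \<subseteq> PosFun"
      unfolding support_def by blast+
    then show "chain_words (F \<union> support x) \<inter> K' \<in> v" using F by (intro word_ultras_chain[OF v]) auto
    show "chain_words (F \<union> support x) \<inter> K' \<subseteq> {y. x @ y \<in> chain_words F \<inter> L}"
      using x K chain_words_append by blast
  qed
  then have "chain_words F \<inter> K \<subseteq> {x. {y. x @ y \<in> chain_words F \<inter> L} \<in> v}" by blast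
  then show "chain_words F \<inter> L \<in> uf_mult (@) u v"
    unfolding mem_uf_mult by (rule ultra_mono[OF uu word_ultras_chain[OF u F]])
qed

lemma const_words_append: "x @ y \<in> const_words \<longleftrightarrow> x \<in> const_words \<and> y \<in> const_words"
  by (auto simp: const_words_def)

lemma push_subst_word_ultras:
  assumes q: "q \<in> word_ultras K" and f: "f \<in> PosFun"
  shows "push UNIV (subst f) q \<in> word_ultras const_words"
  unfolding word_ultras_def
proof (intro CollectI conjI allI impI)
  note uq = word_ultras_ultra[OF q]
  show "ultra (push UNIV (subst f) q)"
    using uq by (intro ultrafilter_on_push) (auto simp: ultrafilter_on_def)
  fix F :: "(nat \<Rightarrow> nat) set" assume F: "finite F" "F \<subseteq> PosFun"
  \<comment> \<open>Above a set containing f, replacing the variable by f gives admissible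
    letters.\<close>
  have "chain_words (insert f F) \<inter> K \<in> q"
    using F f by (intro word_ultras_chain[OF q]) auto
  moreover have "chain_words (insert f F) \<inter> K \<subseteq> subst f -` (chain_words F \<inter> const_words)"
    using subst_chain_words[of _ "insert f F" f] chain_words_antimono[of F "insert f F"] by blast
  ultimately have "subst f -` (chain_words F \<inter> const_words) \<in> q"
    by (rule ultra_mono[OF uq])
  then show "chain_words F \<inter> const_words \<in> push UNIV (subst f) q" by (simp add: push_def)
qed

lemma push_subst_const:
  assumes u: "u \<in> word_ultras const_words"
  shows "push UNIV (subst f) u = u"
proof -
  note uu = word_ultras_ultra[OF u]
  have "const_words \<in> u"
    by (rule ultra_mono[OF uu word_ultras_chain[OF u, of "{}"]]) auto
  moreover have "subst f -` A \<inter> const_words = A \<inter> const_words" for A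
    using subst_const by auto
  ultimately have "subst f -` A \<in> u \<longleftrightarrow> A \<in> u" for A
    by (rule ultra_cong[OF uu])
  then show ?thesis by (auto simp: push_def)
qed

text \<open>A Hales-Jewett argument. For f in F the image of q under substitution is u, so the
  preimage of A is in q; the intersection of these finitely many preimages is in q too, and any word
  with a variable from it serves all f at once.\<close>

lemma word_idempotent_exists:
  obtains u where "u \<in> word_ultras const_words" "uf_mult (@) u u = u"
    "\<And>F A. finite F \<Longrightarrow> F \<subseteq> PosFun \<Longrightarrow> A \<in> u \<Longrightarrow>
       \<exists>w\<in>chain_words {} - const_words. \<forall>f\<in>F. subst f w \<in> A"
proof -
  let ?U = "word_ultras const_words" and ?I = "word_ultras (- const_words)"
  have U: "closed_subsemigroup (@) ?U"
    unfolding closed_subsemigroup_def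
  proof (intro conjI ballI)
    show "uf_closed ?U" by (rule word_ultras_closed)
    show "?U \<noteq> {}" by (rule word_ultras_nonempty[OF chain_words_nonempty(1)])
    show "uf_mult (@) x y \<in> ?U" if "x \<in> ?U" "y \<in> ?U" for x y
      by (rule word_ultras_mult[OF that]) (simp add: const_words_append)
  qed
  have I: "closed_subsemigroup (@) ?I"
    unfolding closed_subsemigroup_def
  proof (intro conjI ballI)
    show "uf_closed ?I" by (rule word_ultras_closed)
    show "?I \<noteq> {}" by (rule word_ultras_nonempty[OF chain_words_nonempty(2)])
    show "uf_mult (@) x y \<in> ?I" if "x \<in> ?I" "y \<in> ?I" for x y
      by (rule word_ultras_mult[OF that]) (simp add: const_words_append)
  qed
  obtain u where u: "u \<in> ?U" "uf_mult (@) u u = u" and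
    min: "\<And>q. q \<in> ?U \<Longrightarrow> uf_mult (@) q q = q \<Longrightarrow> uf_mult (@) q u = q \<Longrightarrow> uf_mult (@) u q = q \<Longrightarrow> q = u"
    by (rule append.minimal_idempotent_exists[OF U]) blast
  have uu: "ultra u" using word_ultras_ultra[OF u(1)] .
  have ideal1: "uf_mult (@) x u \<in> ?I" if "x \<in> ?I" for x
    by (rule word_ultras_mult[OF that u(1)]) (simp add: const_words_append)
  have ideal2: "uf_mult (@) u x \<in> ?I" if "x \<in> ?I" for x
    by (rule word_ultras_mult[OF u(1) that]) (simp add: const_words_append)
  obtain q where q: "q \<in> ?I" "uf_mult (@) q q = q" "uf_mult (@) q u = q" "uf_mult (@) u q = q"
    by (rule append.idempotent_below[OF I uu u(2) ideal1 ideal2])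
  \<comment> \<open>Substitution is a homomorphism and fixes u, which lives on constant words. It
    therefore carries the equations between q and u to the image of q, as \<open>min\<close>
    requires.\<close>
  have push: "push UNIV (subst f) q = u" if f: "f \<in> PosFun" for f
  proof (rule min)
    let ?\<theta> = "push UNIV (subst f)"
    show "?\<theta> q \<in> ?U" using push_subst_word_ultras[OF q(1) f] .
    have hom: "?\<theta> (uf_mult (@) x y) = uf_mult (@) (?\<theta> x) (?\<theta> y)" for x y
      by (intro push_uf_mult subst_append)
    note fixu = push_subst_const[OF u(1)]
    show "uf_mult (@) (?\<theta> q) (?\<theta> q) = ?\<theta> q" using hom[of q q] q(2) by simp
    show "uf_mult (@) (?\<theta> q) u = ?\<theta> q" using hom[of q u] q(3) fixu by simp
    show "uf_mult (@) u (?\<theta> q) = ?\<theta> q" using hom[of u q] q(4) fixu by simp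
  qed
  show thesis
  proof (rule that[OF u])
    fix F A assume F: "finite F" "F \<subseteq> PosFun" "A \<in> u"
    have uq: "ultra q" using word_ultras_ultra[OF q(1)] .
    have "(\<lambda>f. subst f -` A) ` F \<subseteq> q"
      using push F(2,3) by (auto simp: push_def)
    then have "UNIV \<inter> (\<Inter>f\<in>F. subst f -` A) \<in> q"
      using F(1) by (intro ultrafilter_on_Inter[OF uq]) auto
    moreover have "chain_words {} \<inter> - const_words \<in> q"
      using word_ultras_chain[OF q(1)] by simp
    ultimately have "(chain_words {} \<inter> - const_words) \<inter> (\<Inter>f\<in>F. subst f -` A) \<in> q"
      using ultra_Int_iff[OF uq] by simp
    from ultrafilter_on_nonempty[OF uq this] obtain w
      where "w \<in> (chain_words {} \<inter> - const_words) \<inter> (\<Inter>f\<in>F. subst f -` A)" by blast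
    then show "\<exists>w\<in>chain_words {} - const_words. \<forall>f\<in>F. subst f w \<in> A"
      by (intro bexI[of _ w]) auto
  qed
qed

section \<open>Evaluation of words\<close>

definition term_value ::
  "((nat \<Rightarrow> nat) set \<Rightarrow> nat) \<Rightarrow> ((nat \<Rightarrow> nat) set \<Rightarrow> nat set) \<Rightarrow>
     (nat \<Rightarrow> nat) set \<times> (nat \<Rightarrow> nat) option \<Rightarrow> nat" where
  "term_value \<alpha> H x = \<alpha> (fst x) + (\<Sum>t\<in>H (fst x). the (snd x) t)"

definition word_value ::
  "((nat \<Rightarrow> nat) set \<Rightarrow> nat) \<Rightarrow> ((nat \<Rightarrow> nat) set \<Rightarrow> nat set) \<Rightarrow> word \<Rightarrow> nat" where
  "word_value \<alpha> H w = sum_list (map (term_value \<alpha> H) w)"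

lemma word_value_append: "word_value \<alpha> H (w @ v) = word_value \<alpha> H w + word_value \<alpha> H v"
  by (simp add: word_value_def)

text \<open>The value of \<alpha> at the first letter makes the sum positive, so this also holds for
  words with a variable, where \<open>the\<close> is unspecified.\<close>

lemma word_value_pos:
  assumes "\<alpha> \<in> Pf PosFun \<rightarrow> PosN" "w \<in> chain_words F"
  shows "word_value \<alpha> H w \<in> PosN"
proof -
  obtain G c v where w: "w = (G, c) # v"
    using chain_wordsD(1)[OF assms(2)] by (metis list.exhaust surj_pair)
  then have "G \<in> Pf PosFun" using chain_words_fst(2)[OF assms(2)] by simp
  then have "\<alpha> G \<in> PosN" using assms(1) by auto
  then show ?thesis by (simp add: w word_value_def term_value_def PosN_def)
qed

text \<open>
  The constant letters contribute only to \<open>a\<close>; the sets attached to the variable letters are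
  disjoint, because a chain makes the values of \<open>H\<close> consecutive, and their union is \<open>B\<close>.
\<close>
lemma word_value_subst:
  assumes \<alpha>: "\<alpha> \<in> Pf PosFun \<rightarrow> PosN" and H: "H \<in> Pf PosFun \<rightarrow> Pf PosN"
    and before: "\<forall>F\<in>Pf PosFun. \<forall>G\<in>Pf PosFun. F \<subset> G \<longrightarrow> set_before (H F) (H G)"
    and w: "w \<in> chain_words {} - const_words"
  obtains a B where "a \<in> PosN" "B \<in> Pf PosN"
    "\<And>f. word_value \<alpha> H (subst f w) = a + (\<Sum>t\<in>B. f t)"
proof -
  define B where "B v = (\<Union>(G, c)\<in>{x \<in> set v. snd x = None}. H G)" for v :: word
  have main: "\<exists>a. \<forall>f. word_value \<alpha> H (subst f v) = a + (\<Sum>t\<in>B v. f t)"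
    if "\<forall>G\<in>fst ` set v. G \<in> Pf PosFun" "sorted_wrt (\<subset>) (map fst v)" for v
    using that
  proof (induction v)
    case Nil
    then show ?case by (simp add: word_value_def subst_def B_def)
  next
    case (Cons x v)
    obtain G c where x: "x = (G, c)" by fastforce
    obtain a where a: "\<And>f. word_value \<alpha> H (subst f v) = a + (\<Sum>t\<in>B v. f t)"
      using Cons by auto
    have step: "word_value \<alpha> H (subst f (x # v)) =
        term_value \<alpha> H (G, Some (case c of None \<Rightarrow> f | Some g \<Rightarrow> g)) + (a + (\<Sum>t\<in>B v. f t))" for f
      using a[of f] by (simp add: word_value_def subst_def x)
    show ?case
    proof (cases c)
      case None
      have HG: "H G \<in> Pf PosN" using H Cons.prems(1) x by auto
      have Bv: "finite (B v)" "H G \<inter> B v = {}"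
      proof -
        have "finite (H G') \<and> H G \<inter> H G' = {}" if "(G', c') \<in> set v" for G' c'
        proof -
          have G': "G' \<in> Pf PosFun" "G \<subset> G'" using Cons.prems that x by force+
          then have HG': "H G' \<in> Pf PosN" "set_before (H G) (H G')"
            using H before Cons.prems(1) x by auto
          have "s < t" if "s \<in> H G" "t \<in> H G'" for s t
          proof -
            have "s \<le> Max (H G)" "Min (H G') \<le> t"
              using HG HG'(1) that by (simp_all add: Pf_def)
            then show ?thesis using HG'(2) by (simp add: set_before_def)
          qed
          then show ?thesis using HG'(1) by (auto simp: Pf_def)
        qed
        then show "finite (B v)" "H G \<inter> B v = {}" by (auto simp: B_def)
      qed
      have "B (x # v) = H G \<union> B v" by (auto simp: B_def x None)
      then have "(\<Sum>t\<in>B (x # v). f t) = (\<Sum>t\<in>H G. f t) + (\<Sum>t\<in>B v. f t)" for f :: "nat \<Rightarrow> nat"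
        using Bv HG by (simp add: sum.union_disjoint Pf_def)
      then show ?thesis
        by (intro exI[of _ "\<alpha> G + a"]) (simp add: step None term_value_def)
    next
      case (Some g)
      have "B (x # v) = B v" by (auto simp: B_def x Some)
      then show ?thesis
        by (intro exI[of _ "term_value \<alpha> H (G, Some g) + a"]) (simp add: step Some)
    qed
  qed
  have wc: "w \<in> chain_words {}" using w by blast
  obtain a where a: "\<And>f. word_value \<alpha> H (subst f w) = a + (\<Sum>t\<in>B w. f t)"
    using main chain_words_fst(2)[OF wc] chain_wordsD(2)[OF wc] by blast
  have "H G \<in> Pf PosN" if "(G, c) \<in> set w" for G c
    using H chain_wordsD(3)[OF wc that] by auto
  \<comment> \<open>The variable letter makes B nonempty.\<close>
  moreover obtain G where "(G, None) \<in> set w"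
    using w by (force simp: const_words_def)
  ultimately have B: "B w \<in> Pf PosN"
    unfolding Pf_def B_def by fastforce
  \<comment> \<open>At the zero function the sum over B vanishes, so a is the value of the word
    there. Zero is not in \<open>PosFun\<close>, hence the direct computation from the first
    letter.\<close>
  have "word_value \<alpha> H (subst (\<lambda>_. 0) w) \<in> PosN"
  proof -
    obtain G c v where v: "w = (G, c) # v"
      using chain_wordsD(1)[OF wc] by (metis list.exhaust surj_pair)
    then have "G \<in> Pf PosFun" using chain_words_fst(2)[OF wc] by simp
    then have "\<alpha> G \<in> PosN" using \<alpha> by auto
    then show ?thesis by (simp add: v subst_def word_value_def term_value_def PosN_def)
  qed
  then have "a \<in> PosN" using a[of "\<lambda>_. 0"] by simp
  then show thesis using B a by (rule that)
qed

text \<open>A finite chain has to be prolonged to an infinite one before a property of sequences can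
  be applied to it. F may be empty, so only the terms after \<open>E 0\<close> are claimed to be in
  \<open>Pf PosFun\<close>.\<close>

lemma increasing_extension:
  assumes "finite F" "F \<subseteq> PosFun"
  obtains E where "E 0 = F" "\<And>i. E (Suc i) \<in> Pf PosFun" "\<And>i. E i \<subset> E (Suc i)"
proof -
  have "\<exists>E. \<forall>i. (finite (E i) \<and> E i \<subseteq> PosFun \<and> (i = 0 \<longrightarrow> E i = F)) \<and>
      (E (Suc i) \<in> Pf PosFun \<and> E i \<subset> E (Suc i))"
  proof (rule dependent_nat_choice)
    fix X and i :: nat assume X: "finite X \<and> X \<subseteq> PosFun \<and> (i = 0 \<longrightarrow> X = F)"
    then obtain G g where "X \<subset> G" "G \<in> Pf PosFun" "g \<in> G" using Pf_PosFun_above by metis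
    then show "\<exists>Y. (finite Y \<and> Y \<subseteq> PosFun \<and> (Suc i = 0 \<longrightarrow> Y = F)) \<and>
        Y \<in> Pf PosFun \<and> X \<subset> Y" by (auto simp: Pf_def)
  qed (use assms in auto)
  then obtain E where "\<forall>i. (finite (E i) \<and> E i \<subseteq> PosFun \<and> (i = 0 \<longrightarrow> E i = F)) \<and>
      (E (Suc i) \<in> Pf PosFun \<and> E i \<subset> E (Suc i))" by (elim exE)
  then show thesis by (intro that[of E]) (simp_all only: simp_thms)
qed

section \<open>Block sums and tensor powers of the image ultrafilter\<close>

text \<open>The tuples of the first statement that are visible in a finite constant chain. Positions
  count from 1 as in the sequences, whence the index i - 1; the empty word provides a start at k =
  0.\<close>

definition word_tuples ::
  "((nat \<Rightarrow> nat) set \<Rightarrow> nat) \<Rightarrow> ((nat \<Rightarrow> nat) set \<Rightarrow> nat set) \<Rightarrow> nat \<Rightarrow> nat list set" where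
  "word_tuples \<alpha> H k = {map (\<lambda>j. \<Sum>i\<in>\<beta> j. term_value \<alpha> H (w ! (i - 1))) [1..<k + 1] | w \<beta>.
     (w = [] \<or> w \<in> chain_words {} \<inter> const_words) \<and>
     (\<forall>j\<in>{1..k}. \<beta> j \<in> Pf {1..length w}) \<and>
     (\<forall>j\<in>{1..<k}. set_before (\<beta> j) (\<beta> (j + 1)))}"

lemma word_tuples_tuples:
  assumes "\<alpha> \<in> Pf PosFun \<rightarrow> PosN"
  shows "word_tuples \<alpha> H k \<subseteq> tuples k"
proof
  fix xs assume "xs \<in> word_tuples \<alpha> H k"
  then obtain w \<beta> where xs: "xs = map (\<lambda>j. \<Sum>i\<in>\<beta> j. term_value \<alpha> H (w ! (i - 1))) [1..<k + 1]"
    and w: "w = [] \<or> w \<in> chain_words {} \<inter> const_words"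
    and \<beta>: "\<forall>j\<in>{1..k}. \<beta> j \<in> Pf {1..length w}"
    unfolding word_tuples_def by blast
  have "(\<Sum>i\<in>\<beta> j. term_value \<alpha> H (w ! (i - 1))) \<in> PosN" if "j \<in> {1..k}" for j
  proof -
    have b: "finite (\<beta> j)" "\<beta> j \<noteq> {}" "\<beta> j \<subseteq> {1..length w}" using \<beta> that by (auto simp: Pf_def)
    then have wc: "w \<in> chain_words {}" using w by force
    have "0 < term_value \<alpha> H (w ! (i - 1))" if "i \<in> \<beta> j" for i
    proof -
      have "w ! (i - 1) \<in> set w" using that b(3) by (intro nth_mem) force
      then have "fst (w ! (i - 1)) \<in> Pf PosFun" by (intro chain_words_fst(2)[OF wc]) simp
      then have "\<alpha> (fst (w ! (i - 1))) \<in> PosN" using assms by blast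
      then show ?thesis by (simp add: term_value_def PosN_def)
    qed
    then show ?thesis using b by (simp add: PosN_def sum_pos)
  qed
  then show "xs \<in> tuples k" unfolding xs tuples_def by auto
qed

text \<open>v is appended to w and all its positions together form the new last block, so the new
  entry is the value of v.\<close>

lemma word_tuples_snoc:
  assumes w: "w = [] \<or> w \<in> chain_words {} \<inter> const_words"
    and \<beta>: "\<forall>j\<in>{1..k}. \<beta> j \<in> Pf {1..length w}" "\<forall>j\<in>{1..<k}. set_before (\<beta> j) (\<beta> (j + 1))"
    and xs: "xs = map (\<lambda>j. \<Sum>i\<in>\<beta> j. term_value \<alpha> H (w ! (i - 1))) [1..<k + 1]"
    and v: "v \<in> chain_words (support w) \<inter> const_words"
  shows "xs @ [word_value \<alpha> H v] \<in> word_tuples \<alpha> H (Suc k)"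
proof -
  define \<beta>' where "\<beta>' = \<beta>(Suc k := {length w + 1..length w + length v})"
  have vne: "v \<noteq> []" using chain_wordsD(1) v by blast
  have wv: "w @ v \<in> chain_words {} \<inter> const_words"
  proof (cases "w = []")
    case True
    then show ?thesis using v by (simp add: support_def)
  next
    case False
    then show ?thesis
      using w v chain_words_append[of w "{}" v] const_words_append[of w v] by auto
  qed
  have new: "(\<Sum>i\<in>\<beta>' (Suc k). term_value \<alpha> H ((w @ v) ! (i - 1))) = word_value \<alpha> H v"
  proof -
    have "\<beta>' (Suc k) = (\<lambda>i. length w + 1 + i) ` {..<length v}"
    proof (rule set_eqI)
      fix n
      show "n \<in> \<beta>' (Suc k) \<longleftrightarrow> n \<in> (\<lambda>i. length w + 1 + i) ` {..<length v}"
        by (auto simp: \<beta>'_def image_iff intro!: bexI[of _ "n - (length w + 1)"])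
    qed
    then have "(\<Sum>i\<in>\<beta>' (Suc k). term_value \<alpha> H ((w @ v) ! (i - 1))) =
        (\<Sum>i<length v. term_value \<alpha> H (v ! i))"
      by (simp add: sum.reindex inj_on_def nth_append)
    also have "\<dots> = word_value \<alpha> H v"
      by (simp add: word_value_def sum_list_sum_nth atLeast0LessThan)
    finally show ?thesis .
  qed
  have old: "(\<Sum>i\<in>\<beta>' j. term_value \<alpha> H ((w @ v) ! (i - 1))) =
      (\<Sum>i\<in>\<beta> j. term_value \<alpha> H (w ! (i - 1)))" if "j \<in> {1..k}" for j
  proof -
    have "\<beta>' j = \<beta> j" using that by (simp add: \<beta>'_def)
    moreover have "\<beta> j \<subseteq> {1..length w}" using \<beta>(1) that by (auto simp: Pf_def)
    then have "(w @ v) ! (i - 1) = w ! (i - 1)" if "i \<in> \<beta> j" for i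
      using that by (force simp: nth_append)
    ultimately show ?thesis by simp
  qed
  have "xs = map (\<lambda>j. \<Sum>i\<in>\<beta>' j. term_value \<alpha> H ((w @ v) ! (i - 1))) [1..<k + 1]"
    unfolding xs by (intro map_cong refl old[symmetric]) auto
  then have "xs @ [word_value \<alpha> H v] =
      map (\<lambda>j. \<Sum>i\<in>\<beta>' j. term_value \<alpha> H ((w @ v) ! (i - 1))) [1..<Suc k + 1]"
    using new by simp
  moreover have "\<beta>' j \<in> Pf {1..length (w @ v)}" if "j \<in> {1..Suc k}" for j
  proof (cases "j = Suc k")
    case True
    then show ?thesis using vne by (auto simp: \<beta>'_def Pf_def Suc_le_eq)
  next
    case False
    then have "\<beta> j \<in> Pf {1..length w}" using \<beta>(1) that by simp
    then show ?thesis using False by (auto simp: \<beta>'_def Pf_def)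
  qed
  moreover have "set_before (\<beta>' j) (\<beta>' (j + 1))" if "j \<in> {1..<Suc k}" for j
  proof (cases "j = k")
    case True
    then have b: "\<beta> k \<in> Pf {1..length w}" using \<beta>(1) that by simp
    then have "Max (\<beta> k) \<in> \<beta> k" by (intro Max_in) (auto simp: Pf_def)
    then have "Max (\<beta> k) \<le> length w" using b unfolding Pf_def by fastforce
    moreover have "Min (\<beta>' (Suc k)) = length w + 1"
      using vne by (intro Min_eqI) (auto simp: \<beta>'_def Suc_le_eq)
    ultimately show ?thesis by (simp add: set_before_def \<beta>'_def True)
  next
    case False
    then show ?thesis using \<beta>(2) that by (simp add: \<beta>'_def)
  qed
  ultimately show ?thesis
    unfolding word_tuples_def using wv by blast
qed

text \<open>A k-tuple read from w can be prolonged by the value of each constant word v above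
  \<open>support w\<close>, and these v form a member of u. This gives one recursion step of the
  tensor power after another.\<close>

lemma push_word_tuples_tensor:
  assumes \<alpha>: "\<alpha> \<in> Pf PosFun \<rightarrow> PosN" and u: "u \<in> word_ultras const_words"
    and p: "push PosN (word_value \<alpha> H) u \<in> betaN"
  shows "word_tuples \<alpha> H k \<in> tensor (\<lambda>i. push PosN (word_value \<alpha> H) u) k"
proof (induction k)
  case 0
  have "word_tuples \<alpha> H 0 = {[]}" by (auto simp: word_tuples_def)
  then show ?case by simp
next
  case (Suc k)
  let ?p = "push PosN (word_value \<alpha> H) u"
  let ?C = "{xs \<in> tuples k. {x \<in> PosN. xs @ [x] \<in> word_tuples \<alpha> H (Suc k)} \<in> ?p}"
  have "word_tuples \<alpha> H k \<subseteq> ?C"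
  proof
    fix xs assume "xs \<in> word_tuples \<alpha> H k"
    then have xk: "xs \<in> tuples k" using word_tuples_tuples[OF \<alpha>] by blast
    obtain w \<beta> where w: "w = [] \<or> w \<in> chain_words {} \<inter> const_words"
      and wb: "\<forall>j\<in>{1..k}. \<beta> j \<in> Pf {1..length w}" "\<forall>j\<in>{1..<k}. set_before (\<beta> j) (\<beta> (j + 1))"
        "xs = map (\<lambda>j. \<Sum>i\<in>\<beta> j. term_value \<alpha> H (w ! (i - 1))) [1..<k + 1]"
      using \<open>xs \<in> word_tuples \<alpha> H k\<close> unfolding word_tuples_def by blast
    have "finite G \<and> G \<subseteq> PosFun" if "G \<in> fst ` set w" for G
      using chain_words_fst(2)[OF _ that, of "{}"] w that by (auto simp: Pf_def)
    then have "finite (support w)" "support w \<subseteq> PosFun" unfolding support_def by blast+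
    from word_ultras_chain[OF u this]
    have "word_value \<alpha> H -` {x \<in> PosN. xs @ [x] \<in> word_tuples \<alpha> H (Suc k)} \<in> u"
      using word_tuples_snoc[OF w wb] word_value_pos[OF \<alpha>]
      by (elim ultra_mono[OF word_ultras_ultra[OF u]]) auto
    then show "xs \<in> ?C" using xk by (auto simp: push_def)
  qed
  then have "?C \<in> tensor (\<lambda>i. ?p) k" using tensor_mono[OF p Suc] by blast
  then show ?case using word_tuples_tuples[OF \<alpha>] by (simp add: tensor_Suc)
qed

text \<open>The chain of w is prolonged to an infinite one by \<open>increasing_extension\<close>;
  blocks of positions in w do not see the added terms.\<close>

lemma word_tuples_subset:
  assumes rf: "ramsey_functions m A \<alpha> H"
  shows "word_tuples \<alpha> H m \<subseteq> A"
proof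
  fix xs assume "xs \<in> word_tuples \<alpha> H m"
  then obtain w \<beta> where w: "w = [] \<or> w \<in> chain_words {} \<inter> const_words"
    and \<beta>: "\<forall>j\<in>{1..m}. \<beta> j \<in> Pf {1..length w}" "\<forall>j\<in>{1..<m}. set_before (\<beta> j) (\<beta> (j + 1))"
    and xs: "xs = map (\<lambda>j. \<Sum>i\<in>\<beta> j. term_value \<alpha> H (w ! (i - 1))) [1..<m + 1]"
    unfolding word_tuples_def by blast
  have wfst: "G \<in> Pf PosFun" if "G \<in> fst ` set w" for G
    using chain_words_fst(2)[OF _ that, of "{}"] w that by auto
  have wsorted: "sorted_wrt (\<subset>) (map fst w)"
    using w chain_wordsD(2) by fastforce
  have wc: "\<exists>g. c = Some g \<and> g \<in> G" if Gc: "(G, c) \<in> set w" for G c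
  proof -
    have "w \<in> chain_words {}" "w \<in> const_words" using w Gc by auto
    then show ?thesis using chain_wordsD(3)[OF _ Gc] Gc by (force simp: const_words_def)
  qed
  have "finite G \<and> G \<subseteq> PosFun" if "G \<in> fst ` set w" for G
    using wfst[OF that] by (simp add: Pf_def)
  then have "finite (support w)" "support w \<subseteq> PosFun" unfolding support_def by blast+
  then obtain E where E: "E 0 = support w" "\<And>i. E (Suc i) \<in> Pf PosFun" "\<And>i. E i \<subset> E (Suc i)"
    by (rule increasing_extension) blast
  define n where "n = length w"
  \<comment> \<open>\<open>E 0\<close> is the support and not a term of the chain: position n + 1
    receives \<open>E 1\<close>, which strictly contains every set in w.\<close>
  define G where "G i = (if i \<le> n then fst (w ! (i - 1)) else E (i - n))" for i
  define f where "f i = (if i \<le> n then the (snd (w ! (i - 1))) else SOME g. g \<in> G i)" for i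
  have wi: "w ! (i - 1) \<in> set w" if "i \<in> PosN" "i \<le> n" for i
    using that by (intro nth_mem) (auto simp: PosN_def n_def)
  have G1: "G i \<in> Pf PosFun" if "i \<in> PosN" for i
  proof (cases "i \<le> n")
    case True
    then show ?thesis using wfst wi[OF that] by (simp add: G_def)
  next
    case False
    then show ?thesis using E(2)[of "i - n - 1"] by (simp add: G_def Suc_diff_Suc)
  qed
  have G2: "G i \<subset> G (i + 1)" if i: "i \<in> PosN" for i
  proof -
    consider "i < n" | "i = n" | "n < i" by linarith
    then show ?thesis
    proof cases
      case 1
      have "map fst w ! (i - 1) \<subset> map fst w ! i"
        using 1 i wsorted by (intro sorted_wrt_nth_less) (auto simp: n_def PosN_def)
      then show ?thesis using 1 by (simp add: G_def n_def)
    next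
      case 2
      then have "G i \<subseteq> E 0" using wi[OF i] by (auto simp: G_def E(1) support_def)
      then show ?thesis using E(3)[of 0] 2 by (auto simp: G_def)
    next
      case 3
      then show ?thesis using E(3)[of "i - n"] by (simp add: G_def Suc_diff_le)
    qed
  qed
  have f: "f i \<in> G i" if i: "i \<in> PosN" for i
  proof (cases "i \<le> n")
    case True
    then show ?thesis
      using wc[of "fst (w ! (i - 1))" "snd (w ! (i - 1))"] wi[OF i] by (auto simp: f_def G_def)
  next
    case False
    have "\<exists>g. g \<in> G i" using G1[OF i] by (auto simp: Pf_def)
    from someI_ex[OF this] show ?thesis using False by (simp add: f_def)
  qed
  have \<beta>': "\<forall>j\<in>{1..m}. \<beta> j \<in> Pf PosN"
    using \<beta>(1) by (fastforce simp: Pf_def PosN_def)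
  have "map (\<lambda>j. \<Sum>i\<in>\<beta> j. (\<alpha> (G i) + (\<Sum>t\<in>H (G i). f i t))) [1..<m + 1] \<in> A"
    using rf[unfolded ramsey_functions_def] G1 G2 f \<beta>' \<beta>(2) by simp
  moreover have eq: "(\<Sum>i\<in>\<beta> j. (\<alpha> (G i) + (\<Sum>t\<in>H (G i). f i t))) =
      (\<Sum>i\<in>\<beta> j. term_value \<alpha> H (w ! (i - 1)))" if "j \<in> {1..m}" for j
  proof (rule sum.cong[OF refl])
    fix i assume "i \<in> \<beta> j"
    then have "i \<le> n" using \<beta>(1) that by (fastforce simp: Pf_def n_def)
    then show "\<alpha> (G i) + (\<Sum>t\<in>H (G i). f i t) = term_value \<alpha> H (w ! (i - 1))"
      by (simp add: G_def f_def term_value_def)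
  qed
  have "xs = map (\<lambda>j. \<Sum>i\<in>\<beta> j. (\<alpha> (G i) + (\<Sum>t\<in>H (G i). f i t))) [1..<m + 1]"
    unfolding xs by (intro map_cong refl eq[symmetric]) auto
  ultimately show "xs \<in> A" by simp
qed

section \<open>The idempotent obtained from given functions, and the equivalence\<close>

text \<open>p is the image of u under evaluation. A member of p pulls back to a member of u, which
  contains all F-instances of one word with a variable; \<open>word_value_subst\<close> gives their
  values the form required of a J-set, with a and B independent of f. Concatenation goes to
  addition, whence p is idempotent.\<close>

lemma ramsey_functions_imp_J_idempotent:
  assumes A: "A \<subseteq> tuples m" and rf: "ramsey_functions m A \<alpha> H"
  shows "\<exists>p\<in>J_ultrafilters. uf_idempotent p \<and> A \<in> tensor (\<lambda>i. p) m"
proof -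
  note rf' = rf[unfolded ramsey_functions_def]
  note \<alpha> = rf'[THEN conjunct1] and H = rf'[THEN conjunct2, THEN conjunct1]
    and before = rf'[THEN conjunct2, THEN conjunct2, THEN conjunct1]
  obtain u where u: "u \<in> word_ultras const_words" "uf_mult (@) u u = u"
    and var: "\<And>F A. finite F \<Longrightarrow> F \<subseteq> PosFun \<Longrightarrow> A \<in> u \<Longrightarrow>
       \<exists>w\<in>chain_words {} - const_words. \<forall>f\<in>F. subst f w \<in> A"
    by (rule word_idempotent_exists) blast
  define h where "h = word_value \<alpha> H"
  define p where "p = push PosN h u"
  note uu = word_ultras_ultra[OF u(1)]
  have hpos: "h -` PosN \<in> u"
    using word_value_pos[OF \<alpha>]
    by (intro ultra_mono[OF uu word_ultras_chain[OF u(1), of "{}"]]) (auto simp: h_def)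
  have pb: "p \<in> betaN"
    unfolding betaN_def p_def using ultrafilter_on_push[OF uu hpos] by simp
  have "J_set X" if X: "X \<in> p" for X
    unfolding J_set_def
  proof (intro conjI ballI)
    show "X \<subseteq> PosN" using X by (simp add: p_def push_def)
    fix F assume F: "F \<in> Pf PosFun"
    have "h -` X \<in> u" using X by (simp add: p_def push_def)
    moreover have "finite F" "F \<subseteq> PosFun" using F by (simp_all add: Pf_def)
    ultimately obtain w where w: "w \<in> chain_words {} - const_words" "\<forall>f\<in>F. subst f w \<in> h -` X"
      using var by meson
    obtain a B where "a \<in> PosN" "B \<in> Pf PosN" "\<And>f. h (subst f w) = a + (\<Sum>t\<in>B. f t)"
      unfolding h_def by (rule word_value_subst[OF \<alpha> H before w(1)]) blast
    then show "\<exists>a\<in>PosN. \<exists>B\<in>Pf PosN. \<forall>f\<in>F. a + (\<Sum>t\<in>B. f t) \<in> X"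
      using w(2) by (intro bexI[of _ a] bexI[of _ B]) auto
  qed
  then have pJ: "p \<in> J_ultrafilters" using pb by (simp add: J_ultrafilters_def)
  have "X \<in> uf_plus p p \<longleftrightarrow> X \<in> p" for X
  proof -
    \<comment> \<open>Since h takes positive values on a member of u, the restrictions to
      \<open>PosN\<close> may be dropped.\<close>
    have inner: "{y \<in> PosN. x + y \<in> X} \<in> p \<longleftrightarrow> {v. x + h v \<in> X} \<in> u" for x
      using hpos by (auto simp: p_def push_def vimage_def ultra_Collect_conj[OF uu])
    have "X \<in> uf_plus p p \<longleftrightarrow> X \<subseteq> PosN \<and> {w. {v. h w + h v \<in> X} \<in> u} \<in> u"
      using hpos
      by (auto simp: uf_plus_def inner) (auto simp: p_def push_def vimage_def ultra_Collect_conj[OF uu])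
    also have "\<dots> \<longleftrightarrow> X \<subseteq> PosN \<and> h -` X \<in> uf_mult (@) u u"
      by (simp add: mem_uf_mult h_def word_value_append vimage_def)
    finally show ?thesis by (simp add: u(2) p_def push_def)
  qed
  then have "uf_idempotent p" by (auto simp: uf_idempotent_def)
  moreover have "A \<in> tensor (\<lambda>i. p) m"
    unfolding p_def h_def
    by (rule tensor_mono[OF _ push_word_tuples_tensor[OF \<alpha> u(1)] word_tuples_subset[OF rf] A])
      (use pb in \<open>simp_all add: p_def h_def\<close>)
  ultimately show ?thesis using pJ by blast
qed

theorem corollary1p24:
  fixes m :: nat and A :: "nat list set"
  assumes "m \<in> PosN" and "A \<subseteq> tuples m"
  shows "(\<exists>(\<alpha> :: (nat \<Rightarrow> nat) set \<Rightarrow> nat) (H :: (nat \<Rightarrow> nat) set \<Rightarrow> nat set).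
            \<alpha> \<in> Pf PosFun \<rightarrow> PosN \<and> H \<in> Pf PosFun \<rightarrow> Pf PosN \<and>
            (\<forall>F \<in> Pf PosFun. \<forall>G \<in> Pf PosFun. F \<subset> G \<longrightarrow> set_before (H F) (H G)) \<and>
            (\<forall>G :: nat \<Rightarrow> (nat \<Rightarrow> nat) set.
               (\<forall>i\<in>PosN. G i \<in> Pf PosFun) \<and> (\<forall>i\<in>PosN. G i \<subset> G (i + 1)) \<longrightarrow>
               (\<forall>(\<beta> :: nat \<Rightarrow> nat set) (f :: nat \<Rightarrow> nat \<Rightarrow> nat).
                  (\<forall>j\<in>{1..m}. \<beta> j \<in> Pf PosN) \<and>
                  (\<forall>j\<in>{1..<m}. set_before (\<beta> j) (\<beta> (j + 1))) \<and>
                  (\<forall>i\<in>PosN. f i \<in> G i) \<longrightarrow>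
                  map (\<lambda>j. \<Sum>i\<in>\<beta> j. (\<alpha> (G i) + (\<Sum>t\<in>H (G i). f i t))) [1..<m + 1] \<in> A)))
         \<longleftrightarrow>
         (\<exists>p \<in> J_ultrafilters. uf_idempotent p \<and> A \<in> tensor (\<lambda>i. p) m)"
  unfolding ramsey_functions_def[symmetric]
proof
  assume "\<exists>\<alpha> H. ramsey_functions m A \<alpha> H"
  then show "\<exists>p\<in>J_ultrafilters. uf_idempotent p \<and> A \<in> tensor (\<lambda>i. p) m"
    by (elim exE) (rule ramsey_functions_imp_J_idempotent[OF assms(2)])
next
  assume "\<exists>p\<in>J_ultrafilters. uf_idempotent p \<and> A \<in> tensor (\<lambda>i. p) m"
  moreover have "0 < m" using assms(1) by (simp add: PosN_def)
  ultimately show "\<exists>\<alpha> H. ramsey_functions m A \<alpha> H"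
    by (elim bexE conjE) (rule J_idempotent_imp_ramsey_functions)
qed

end
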